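(* Let $T$ be a complete $\mathcal{L}$-theory of fields and $M$ a sufficiently saturated model of $T$ contained in a sufficiently saturated algebraically closed field $M_0$. If there is a strong class $\mathcal{K}$ of $\mathcal{L}$-substructures of $M$ such that Hypotheses 1, 2, 3 and 4 (listed in the context) hold, then $T$ satisfies Property ($\divideontimes$).
   Context: Setting: $\mathcal{L}_0=\{0,1,+,-,\cdot,{}^{-1}\}$ is the language of fields, $\mathcal{L}\supseteq\mathcal{L}_0$, and $T$ is a complete $\mathcal{L}$-theory whose models are fields of a fixed characteristic $p$ (prime or $0$). "Small" means of cardinality smaller than the saturation of $M$. $\operatorname{dcl}_{\mathcal{L}},\operatorname{acl}_{\mathcal{L}}$ denote definable and algebraic closure in $M$ in the sense of $T$; $\operatorname{acl}_0$ denotes field-theoretic algebraic closure in $M_0$. "$\mathcal{L}$-independent" means non-forking independent in the sense of $T$. For subfields $A,B$ of $M$, $A\cdot B$ denotes the subfield generated by $A\cup B$. A class $\mathcal{K}$ of $\mathcal{L}$-substructures of $M$ is strong if every $\mathcal{L}$-isomorphism $f:A\to A'$ with $A,A'\in\mathcal{K}$ is elementary (in the sense of $T$). A field extension $F/K$ is separable if the characteristic is $0$, or if the characteristic is $p>0$ and $K$ and $F^p$ are linearly disjoint over $K^p$. Hypothesis 1: $\mathcal{K}$ contains all $\mathcal{L}$-definably closed subsets of $M$. Hypothesis 2: (1) models of $T$ are separably closed as fields; (2) if $A\in\mathcal{K}$, then the field extension $M/A$ is separable. Hypothesis 3: for every $A\in\mathcal{K}$ we have $\operatorname{acl}_{\mathcal{L}}(A)=\operatorname{acl}_0(A)\cap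 M$ (in particular this set is an $\mathcal{L}$-substructure); moreover, every field isomorphism $f:\operatorname{acl}_0(A)\cap M\to\operatorname{acl}_0(A)\cap M$ fixing $A$ pointwise is an $\mathcal{L}$-isomorphism. Hypothesis 4: for every small elementary substructure $N\prec M$ and all $A,B\in\mathcal{K}$ containing $N$ such that $A$ is $\mathcal{L}$-independent from $B$ over $N$, the field $A\cdot B$ is again in $\mathcal{K}$. Property ($\divideontimes$): for every small elementary substructure $N\prec M$ and all sets $A=\operatorname{dcl}_{\mathcal{L}}(A)\supseteq N$ and $B=\operatorname{dcl}_{\mathcal{L}}(B)\supseteq N$ such that $A$ is $\mathcal{L}$-independent from $B$ over $N$, one has $\operatorname{dcl}_{\mathcal{L}}(A\cup B)\subseteq A\cdot B$. *)

theory Defs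
  imports
    "HOL-Algebra.Algebraic_Closure"
    "HOL-Algebra.Generated_Fields"
    "HOL-Computational_Algebra.Primes"
begin

unbundle cardinal_syntax

section \<open>First-order logic\<close>

datatype 'f tm = Var nat | App 'f "'f tm list"

datatype ('f, 'r) fm =
    Eq "'f tm" "'f tm"
  | Rel 'r "'f tm list"
  | Neg "('f, 'r) fm"
  | And "('f, 'r) fm" "('f, 'r) fm"
  | Ex nat "('f, 'r) fm"

record ('f, 'r) language =
  Funs :: "'f set"
  Rels :: "'r set"
  farity :: "'f \<Rightarrow> nat"
  rarity :: "'r \<Rightarrow> nat"

record ('a, 'f, 'r) fo_structure =
  univ :: "'a set"
  fint :: "'f \<Rightarrow> 'a list \<Rightarrow> 'a"
  rint :: "'r \<Rightarrow> 'a list \<Rightarrow> bool"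

definition sublanguage :: "('f, 'r) language \<Rightarrow> ('f, 'r) language \<Rightarrow> bool" where
  "sublanguage L L' \<longleftrightarrow>
     Funs L \<subseteq> Funs L' \<and> (\<forall>g\<in>Funs L. farity L g = farity L' g) \<and>
     Rels L \<subseteq> Rels L' \<and> (\<forall>r\<in>Rels L. rarity L r = rarity L' r)"

definition tuples :: "nat \<Rightarrow> 'a set \<Rightarrow> 'a list set" where
  "tuples n A = {xs. length xs = n \<and> set xs \<subseteq> A}"

fun tm_wf :: "('f, 'r) language \<Rightarrow> 'f tm \<Rightarrow> bool" where
  "tm_wf L (Var i) \<longleftrightarrow> True"
| "tm_wf L (App g ts) \<longleftrightarrow> g \<in> Funs L \<and> length ts = farity L g \<and> (\<forall>t\<in>set ts. tm_wf L t)"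

fun fm_wf :: "('f, 'r) language \<Rightarrow> ('f, 'r) fm \<Rightarrow> bool" where
  "fm_wf L (Eq s t) \<longleftrightarrow> tm_wf L s \<and> tm_wf L t"
| "fm_wf L (Rel r ts) \<longleftrightarrow> r \<in> Rels L \<and> length ts = rarity L r \<and> (\<forall>t\<in>set ts. tm_wf L t)"
| "fm_wf L (Neg \<phi>) \<longleftrightarrow> fm_wf L \<phi>"
| "fm_wf L (And \<phi> \<psi>) \<longleftrightarrow> fm_wf L \<phi> \<and> fm_wf L \<psi>"
| "fm_wf L (Ex i \<phi>) \<longleftrightarrow> fm_wf L \<phi>"

fun tm_fv :: "'f tm \<Rightarrow> nat set" where
  "tm_fv (Var i) = {i}"
| "tm_fv (App g ts) = (\<Union>t\<in>set ts. tm_fv t)"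

fun fv :: "('f, 'r) fm \<Rightarrow> nat set" where
  "fv (Eq s t) = tm_fv s \<union> tm_fv t"
| "fv (Rel r ts) = (\<Union>t\<in>set ts. tm_fv t)"
| "fv (Neg \<phi>) = fv \<phi>"
| "fv (And \<phi> \<psi>) = fv \<phi> \<union> fv \<psi>"
| "fv (Ex i \<phi>) = fv \<phi> - {i}"

fun tm_val :: "('a, 'f, 'r) fo_structure \<Rightarrow> (nat \<Rightarrow> 'a) \<Rightarrow> 'f tm \<Rightarrow> 'a" where
  "tm_val M e (Var i) = e i"
| "tm_val M e (App g ts) = fint M g (map (tm_val M e) ts)"

fun sat :: "('a, 'f, 'r) fo_structure \<Rightarrow> (nat \<Rightarrow> 'a) \<Rightarrow> ('f, 'r) fm \<Rightarrow> bool" where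
  "sat M e (Eq s t) \<longleftrightarrow> tm_val M e s = tm_val M e t"
| "sat M e (Rel r ts) \<longleftrightarrow> rint M r (map (tm_val M e) ts)"
| "sat M e (Neg \<phi>) \<longleftrightarrow> \<not> sat M e \<phi>"
| "sat M e (And \<phi> \<psi>) \<longleftrightarrow> sat M e \<phi> \<and> sat M e \<psi>"
| "sat M e (Ex i \<phi>) \<longleftrightarrow> (\<exists>a\<in>univ M. sat M (e(i := a)) \<phi>)"

definition lformulas :: "('f, 'r) language \<Rightarrow> ('f, 'r) fm set" where
  "lformulas L = {\<phi>. fm_wf L \<phi>}"

definition sentences :: "('f, 'r) language \<Rightarrow> ('f, 'r) fm set" where
  "sentences L = {\<phi> \<in> lformulas L. fv \<phi> = {}}"

definition is_structure :: "('f, 'r) language \<Rightarrow> ('a, 'f, 'r) fo_structure \<Rightarrow> bool" where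
  "is_structure L M \<longleftrightarrow>
     univ M \<noteq> {} \<and> (\<forall>g\<in>Funs L. \<forall>xs\<in>tuples (farity L g) (univ M). fint M g xs \<in> univ M)"

definition is_substructure ::
  "('f, 'r) language \<Rightarrow> ('a, 'f, 'r) fo_structure \<Rightarrow> ('a, 'f, 'r) fo_structure \<Rightarrow> bool" where
  "is_substructure L N M \<longleftrightarrow>
     is_structure L N \<and> is_structure L M \<and> univ N \<subseteq> univ M \<and>
     (\<forall>g\<in>Funs L. \<forall>xs\<in>tuples (farity L g) (univ N). fint N g xs = fint M g xs) \<and>
     (\<forall>r\<in>Rels L. \<forall>xs\<in>tuples (rarity L r) (univ N). rint N r xs = rint M r xs)"

text \<open>From here on a substructure of a fixed structure \<open>M\<close> is given by its universe \<open>A\<close>; the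
  substructure itself is \<open>M\<lparr>univ := A\<rparr>\<close>.\<close>

definition elementary_sub ::
  "('f, 'r) language \<Rightarrow> ('a, 'f, 'r) fo_structure \<Rightarrow> 'a set \<Rightarrow> bool" where
  "elementary_sub L M N \<longleftrightarrow>
     is_substructure L (M\<lparr>univ := N\<rparr>) M \<and>
     (\<forall>\<phi>\<in>lformulas L. \<forall>e. range e \<subseteq> N \<longrightarrow> (sat (M\<lparr>univ := N\<rparr>) e \<phi> \<longleftrightarrow> sat M e \<phi>))"

definition l_iso ::
  "('f, 'r) language \<Rightarrow> ('a, 'f, 'r) fo_structure \<Rightarrow> 'a set \<Rightarrow> 'a set \<Rightarrow> ('a \<Rightarrow> 'a) \<Rightarrow> bool" where
  "l_iso L M A A' f \<longleftrightarrow>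
     bij_betw f A A' \<and>
     (\<forall>g\<in>Funs L. \<forall>xs\<in>tuples (farity L g) A. f (fint M g xs) = fint M g (map f xs)) \<and>
     (\<forall>r\<in>Rels L. \<forall>xs\<in>tuples (rarity L r) A. rint M r xs \<longleftrightarrow> rint M r (map f xs))"

definition elementary_map ::
  "('f, 'r) language \<Rightarrow> ('a, 'f, 'r) fo_structure \<Rightarrow> 'a set \<Rightarrow> ('a \<Rightarrow> 'a) \<Rightarrow> bool" where
  "elementary_map L M A f \<longleftrightarrow>
     (\<forall>\<phi>\<in>lformulas L. \<forall>e. range e \<subseteq> A \<longrightarrow> (sat M e \<phi> \<longleftrightarrow> sat M (f \<circ> e) \<phi>))"

definition is_model ::
  "('f, 'r) language \<Rightarrow> ('f, 'r) fm set \<Rightarrow> ('a, 'f, 'r) fo_structure \<Rightarrow> bool" where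
  "is_model L T M \<longleftrightarrow>
     is_structure L M \<and> (\<forall>\<phi>\<in>T. \<forall>e. range e \<subseteq> univ M \<longrightarrow> sat M e \<phi>)"

text \<open>HOL cannot quantify over all structures of all types, so models are taken with universe a
  subset of a given type \<open>'a\<close>. When \<open>'a\<close> has at least as many elements as there are
  \<open>L\<close>-formulas, this gives the usual consequence relation, by the Loewenheim--Skolem theorem.\<close>

definition entails ::
  "'a itself \<Rightarrow> ('f, 'r) language \<Rightarrow> ('f, 'r) fm set \<Rightarrow> ('f, 'r) fm \<Rightarrow> bool" where
  "entails U L T \<phi> \<longleftrightarrow>
     (\<forall>N :: ('a, 'f, 'r) fo_structure. is_model L T N \<longrightarrow>
        (\<forall>e. range e \<subseteq> univ N \<longrightarrow> sat N e \<phi>))"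

definition complete_theory ::
  "'a itself \<Rightarrow> ('f, 'r) language \<Rightarrow> ('f, 'r) fm set \<Rightarrow> bool" where
  "complete_theory U L T \<longleftrightarrow>
     T \<subseteq> sentences L \<and>
     (\<exists>N :: ('a, 'f, 'r) fo_structure. is_model L T N) \<and>
     (\<forall>\<phi>\<in>sentences L. entails U L T \<phi> \<or> entails U L T (Neg \<phi>))"


section \<open>Types, saturation, definable and algebraic closure, forking\<close>

text \<open>An \<open>L(A)\<close>-formula in the \<open>n\<close> object variables \<open>0, \<dots>, n - 1\<close> is a pair of an \<open>L\<close>-formula
  and an assignment; the free variables with index at least \<open>n\<close> stand for the parameters
  which the assignment gives them.\<close>

definition pformulas ::
  "('f, 'r) language \<Rightarrow> nat \<Rightarrow> 'a set \<Rightarrow> (('f, 'r) fm \<times> (nat \<Rightarrow> 'a)) set" where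
  "pformulas L n A = {(\<phi>, e). \<phi> \<in> lformulas L \<and> (\<forall>i\<in>fv \<phi>. n \<le> i \<longrightarrow> e i \<in> A)}"

definition holds ::
  "('a, 'f, 'r) fo_structure \<Rightarrow> 'a list \<Rightarrow> ('f, 'r) fm \<times> (nat \<Rightarrow> 'a) \<Rightarrow> bool" where
  "holds M xs \<psi> \<longleftrightarrow> sat M (\<lambda>i. if i < length xs then xs ! i else snd \<psi> i) (fst \<psi>)"

definition tp ::
  "('f, 'r) language \<Rightarrow> ('a, 'f, 'r) fo_structure \<Rightarrow> 'a set \<Rightarrow> 'a list \<Rightarrow>
     (('f, 'r) fm \<times> (nat \<Rightarrow> 'a)) set" where
  "tp L M A xs = {\<psi> \<in> pformulas L (length xs) A. holds M xs \<psi>}"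

definition saturated ::
  "('f, 'r) language \<Rightarrow> 'k rel \<Rightarrow> ('a, 'f, 'r) fo_structure \<Rightarrow> bool" where
  "saturated L \<kappa> M \<longleftrightarrow>
     (\<forall>A \<Gamma>. A \<subseteq> univ M \<and> |A| <o \<kappa> \<and> \<Gamma> \<subseteq> pformulas L 1 A \<and>
        (\<forall>\<Gamma>\<^sub>0. \<Gamma>\<^sub>0 \<subseteq> \<Gamma> \<and> finite \<Gamma>\<^sub>0 \<longrightarrow> (\<exists>x\<in>univ M. \<forall>\<psi>\<in>\<Gamma>\<^sub>0. holds M [x] \<psi>))
        \<longrightarrow> (\<exists>x\<in>univ M. \<forall>\<psi>\<in>\<Gamma>. holds M [x] \<psi>))"

definition dcl :: "('f, 'r) language \<Rightarrow> ('a, 'f, 'r) fo_structure \<Rightarrow> 'a set \<Rightarrow> 'a set" where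
  "dcl L M A = {c \<in> univ M. \<exists>\<psi>\<in>pformulas L 1 A. {x \<in> univ M. holds M [x] \<psi>} = {c}}"

definition acl :: "('f, 'r) language \<Rightarrow> ('a, 'f, 'r) fo_structure \<Rightarrow> 'a set \<Rightarrow> 'a set" where
  "acl L M A = {c \<in> univ M. \<exists>\<psi>\<in>pformulas L 1 A.
     finite {x \<in> univ M. holds M [x] \<psi>} \<and> holds M [c] \<psi>}"

text \<open>Dividing over \<open>C\<close> of \<open>\<phi>(x, b)\<close>, where \<open>x\<close> consists of the first \<open>n\<close> variables and the
  \<open>m\<close>-tuple \<open>b\<close> is substituted for the next \<open>m\<close> ones. For \<open>|C|\<close> below the saturation of \<open>M\<close>
  the witnessing sequence can be taken inside \<open>M\<close>, as is done here.\<close>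

definition divides_over ::
  "('f, 'r) language \<Rightarrow> ('a, 'f, 'r) fo_structure \<Rightarrow> 'a set \<Rightarrow> nat \<Rightarrow>
     ('f, 'r) fm \<Rightarrow> 'a list \<Rightarrow> bool" where
  "divides_over L M C n \<phi> b \<longleftrightarrow>
     (\<exists>k>0. \<exists>bs :: nat \<Rightarrow> 'a list.
        (\<forall>i. bs i \<in> tuples (length b) (univ M) \<and> tp L M C (bs i) = tp L M C b) \<and>
        (\<forall>I. finite I \<and> card I = k \<longrightarrow>
           \<not> (\<exists>xs\<in>tuples n (univ M). \<forall>i\<in>I. sat M ((!) (xs @ bs i)) \<phi>)))"

text \<open>A set of \<open>L(M)\<close>-formulas forks over \<open>C\<close> if it implies a finite disjunction of formulas that
  divide over \<open>C\<close>; by compactness the implication needs only a finite part \<open>\<Gamma>\<^sub>0\<close> of the set, and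
  for such a part it can be tested in \<open>M\<close>.\<close>

definition forks_over ::
  "('f, 'r) language \<Rightarrow> ('a, 'f, 'r) fo_structure \<Rightarrow> 'a set \<Rightarrow> nat \<Rightarrow>
     (('f, 'r) fm \<times> (nat \<Rightarrow> 'a)) set \<Rightarrow> bool" where
  "forks_over L M C n \<Gamma> \<longleftrightarrow>
     (\<exists>\<Gamma>\<^sub>0 D. \<Gamma>\<^sub>0 \<subseteq> \<Gamma> \<and> finite \<Gamma>\<^sub>0 \<and> finite D \<and>
        (\<forall>(\<phi>, b)\<in>D. \<phi> \<in> lformulas L \<and> set b \<subseteq> univ M \<and> fv \<phi> \<subseteq> {..<n + length b} \<and>
           divides_over L M C n \<phi> b) \<and>
        (\<forall>xs\<in>tuples n (univ M). (\<forall>\<psi>\<in>\<Gamma>\<^sub>0. holds M xs \<psi>) \<longrightarrow>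
           (\<exists>(\<phi>, b)\<in>D. sat M ((!) (xs @ b)) \<phi>)))"

definition independent_over ::
  "('f, 'r) language \<Rightarrow> ('a, 'f, 'r) fo_structure \<Rightarrow> 'a set \<Rightarrow> 'a set \<Rightarrow> 'a set \<Rightarrow> bool" where
  "independent_over L M C A B \<longleftrightarrow>
     (\<forall>a. set a \<subseteq> A \<longrightarrow> \<not> forks_over L M C (length a) (tp L M (B \<union> C) a))"


section \<open>The language of fields\<close>

datatype 'f fsym = FZero | FOne | FPlus | FMinus | FTimes | FInv | Other 'f

text \<open>Here \<open>FMinus\<close> is the unary symbol for additive inverses.\<close>

definition L0 :: "('f fsym, 'r) language" where
  "L0 = \<lparr>Funs = {FZero, FOne, FPlus, FMinus, FTimes, FInv}, Rels = {},
     farity = (\<lambda>g. case g of FPlus \<Rightarrow> 2 | FTimes \<Rightarrow> 2 | FMinus \<Rightarrow> 1 | FInv \<Rightarrow> 1 | _ \<Rightarrow> 0),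
     rarity = (\<lambda>_. 0)\<rparr>"

text \<open>As usual, \<open>0\<inverse> = 0\<close>.\<close>

fun field_op :: "'a ring \<Rightarrow> 'f fsym \<Rightarrow> 'a list \<Rightarrow> 'a" where
  "field_op R FOne [] = \<one>\<^bsub>R\<^esub>"
| "field_op R FPlus [x, y] = x \<oplus>\<^bsub>R\<^esub> y"
| "field_op R FTimes [x, y] = x \<otimes>\<^bsub>R\<^esub> y"
| "field_op R FMinus [x] = \<ominus>\<^bsub>R\<^esub> x"
| "field_op R FInv [x] = (if x = \<zero>\<^bsub>R\<^esub> then \<zero>\<^bsub>R\<^esub> else inv\<^bsub>R\<^esub> x)"
| "field_op R _ _ = \<zero>\<^bsub>R\<^esub>"

definition field_structure :: "'a ring \<Rightarrow> ('a, 'f fsym, 'r) fo_structure" where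
  "field_structure R = \<lparr>univ = carrier R, fint = field_op R, rint = (\<lambda>_ _. False)\<rparr>"

definition ring_of :: "('a, 'f fsym, 'r) fo_structure \<Rightarrow> 'a ring" where
  "ring_of M = \<lparr>carrier = univ M, monoid.mult = (\<lambda>x y. fint M FTimes [x, y]), one = fint M FOne [],
     ring.zero = fint M FZero [], add = (\<lambda>x y. fint M FPlus [x, y])\<rparr>"

definition is_field_structure :: "('a, 'f fsym, 'r) fo_structure \<Rightarrow> bool" where
  "is_field_structure M \<longleftrightarrow>
     field (ring_of M) \<and> is_substructure L0 M (field_structure (ring_of M))"


section \<open>Fields\<close>

definition has_char :: "'a ring \<Rightarrow> nat \<Rightarrow> bool" where
  "has_char R p \<longleftrightarrow> (\<forall>n::nat. [n] \<cdot>\<^bsub>R\<^esub> \<one>\<^bsub>R\<^esub> = \<zero>\<^bsub>R\<^esub> \<longleftrightarrow> p dvd n)"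

definition compositum :: "'a ring \<Rightarrow> 'a set \<Rightarrow> 'a set \<Rightarrow> 'a set" where
  "compositum R A B = generate_field R (A \<union> B)"

definition acl_field :: "'a ring \<Rightarrow> 'a set \<Rightarrow> 'a set" where
  "acl_field R A = {x \<in> carrier R. (ring.algebraic R over generate_field R A) x}"

text \<open>Polynomials of \<^theory>\<open>HOL-Algebra.Polynomials\<close> are coefficient lists, leading coefficient
  first; in \<open>a # q\<close> the coefficient \<open>a\<close> belongs to the power \<open>length q\<close>.\<close>

fun deriv_coeffs :: "'a ring \<Rightarrow> 'a list \<Rightarrow> 'a list" where
  "deriv_coeffs R [] = []"
| "deriv_coeffs R [a] = []"
| "deriv_coeffs R (a # q) = ([length q] \<cdot>\<^bsub>R\<^esub> a) # deriv_coeffs R q"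

definition formal_deriv :: "'a ring \<Rightarrow> 'a list \<Rightarrow> 'a list" where
  "formal_deriv R q = ring.normalize R (deriv_coeffs R q)"

definition separable_poly :: "'a ring \<Rightarrow> 'a list \<Rightarrow> bool" where
  "separable_poly R q \<longleftrightarrow>
     q \<in> carrier (poly_ring R) \<and>
     (\<exists>u\<in>carrier (poly_ring R). \<exists>v\<in>carrier (poly_ring R).
        (u \<otimes>\<^bsub>poly_ring R\<^esub> q) \<oplus>\<^bsub>poly_ring R\<^esub> (v \<otimes>\<^bsub>poly_ring R\<^esub> formal_deriv R q)
          = \<one>\<^bsub>poly_ring R\<^esub>)"

definition separably_closed :: "'a ring \<Rightarrow> bool" where
  "separably_closed R \<longleftrightarrow> field R \<and> (\<forall>q. separable_poly R q \<longrightarrow> ring.splitted R q)"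

definition linearly_disjoint :: "'a ring \<Rightarrow> 'a set \<Rightarrow> 'a set \<Rightarrow> 'a set \<Rightarrow> bool" where
  "linearly_disjoint R E F K \<longleftrightarrow>
     (\<forall>us. set us \<subseteq> E \<and> ring.independent R K us \<longrightarrow> ring.independent R F us)"

definition separable_ext :: "'a ring \<Rightarrow> nat \<Rightarrow> 'a set \<Rightarrow> 'a set \<Rightarrow> bool" where
  "separable_ext R p F K \<longleftrightarrow>
     p = 0 \<or>
     linearly_disjoint R K ((\<lambda>x. x [^]\<^bsub>R\<^esub> p) ` F) ((\<lambda>x. x [^]\<^bsub>R\<^esub> p) ` K)"


section \<open>Strong classes, the hypotheses and the property\<close>

definition substructure_class ::
  "('f, 'r) language \<Rightarrow> ('a, 'f, 'r) fo_structure \<Rightarrow> 'a set set \<Rightarrow> bool" where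
  "substructure_class L M \<K> \<longleftrightarrow> (\<forall>A\<in>\<K>. is_substructure L (M\<lparr>univ := A\<rparr>) M)"

definition strong_class ::
  "('f, 'r) language \<Rightarrow> ('a, 'f, 'r) fo_structure \<Rightarrow> 'a set set \<Rightarrow> bool" where
  "strong_class L M \<K> \<longleftrightarrow>
     (\<forall>A\<in>\<K>. \<forall>A'\<in>\<K>. \<forall>f. l_iso L M A A' f \<longrightarrow> elementary_map L M A f)"

definition hypothesis_1 ::
  "('f, 'r) language \<Rightarrow> ('a, 'f, 'r) fo_structure \<Rightarrow> 'a set set \<Rightarrow> bool" where
  "hypothesis_1 L M \<K> \<longleftrightarrow> (\<forall>A. A \<subseteq> univ M \<and> dcl L M A = A \<longrightarrow> A \<in> \<K>)"

definition hypothesis_2 ::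
  "('f fsym, 'r) language \<Rightarrow> ('f fsym, 'r) fm set \<Rightarrow> nat \<Rightarrow> 'a ring \<Rightarrow>
     ('a, 'f fsym, 'r) fo_structure \<Rightarrow> 'a set set \<Rightarrow> bool" where
  "hypothesis_2 L T p M\<^sub>0 M \<K> \<longleftrightarrow>
     (\<forall>N :: ('a, 'f fsym, 'r) fo_structure. is_model L T N \<longrightarrow> separably_closed (ring_of N)) \<and>
     (\<forall>A\<in>\<K>. separable_ext M\<^sub>0 p (univ M) A)"

definition hypothesis_3 ::
  "('f fsym, 'r) language \<Rightarrow> 'a ring \<Rightarrow> ('a, 'f fsym, 'r) fo_structure \<Rightarrow> 'a set set \<Rightarrow> bool" where
  "hypothesis_3 L M\<^sub>0 M \<K> \<longleftrightarrow>
     (\<forall>A\<in>\<K>. let E = acl_field M\<^sub>0 A \<inter> univ M in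
        acl L M A = E \<and>
        is_substructure L (M\<lparr>univ := E\<rparr>) M \<and>
        (\<forall>f\<in>ring_iso (M\<^sub>0\<lparr>carrier := E\<rparr>) (M\<^sub>0\<lparr>carrier := E\<rparr>).
           (\<forall>a\<in>A. f a = a) \<longrightarrow> l_iso L M E E f))"

definition hypothesis_4 ::
  "('f fsym, 'r) language \<Rightarrow> 'k rel \<Rightarrow> 'a ring \<Rightarrow>
     ('a, 'f fsym, 'r) fo_structure \<Rightarrow> 'a set set \<Rightarrow> bool" where
  "hypothesis_4 L \<kappa> M\<^sub>0 M \<K> \<longleftrightarrow>
     (\<forall>N. elementary_sub L M N \<and> |N| <o \<kappa> \<longrightarrow>
        (\<forall>A\<in>\<K>. \<forall>B\<in>\<K>. N \<subseteq> A \<and> N \<subseteq> B \<and> independent_over L M N A B \<longrightarrow>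
           compositum M\<^sub>0 A B \<in> \<K>))"

definition property_star ::
  "('f fsym, 'r) language \<Rightarrow> 'k rel \<Rightarrow> 'a ring \<Rightarrow> ('a, 'f fsym, 'r) fo_structure \<Rightarrow> bool" where
  "property_star L \<kappa> M\<^sub>0 M \<longleftrightarrow>
     (\<forall>N. elementary_sub L M N \<and> |N| <o \<kappa> \<longrightarrow>
        (\<forall>A B. A \<subseteq> univ M \<and> B \<subseteq> univ M \<and> A = dcl L M A \<and> B = dcl L M B \<and>
           N \<subseteq> A \<and> N \<subseteq> B \<and> independent_over L M N A B \<longrightarrow>
           dcl L M (A \<union> B) \<subseteq> compositum M\<^sub>0 A B))"

end

theory Submission
  imports Defs
begin

text \<open>With \<open>C = A \<cdot> B\<close>, which lies in \<open>\<K>\<close> by Hypothesis 4, let \<open>E = acl(C)\<close>. By Hypothesis 3 it is the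
  relative algebraic closure of \<open>C\<close> in \<open>M\<close>, and it lies in \<open>\<K>\<close> because it is definably closed.
  Suppose that \<open>c\<close> in \<open>dcl(A \<union> B)\<close> is not in \<open>C\<close>. Since \<open>M/C\<close> is separable and \<open>M\<close> is separably
  closed, the minimal polynomial over \<open>C\<close> of every element of \<open>E\<close> splits into distinct linear factors
  over \<open>M\<close>. So some field automorphism of \<open>E\<close> over \<open>C\<close> moves \<open>c\<close>. It is an \<open>L\<close>-isomorphism by
  Hypothesis 3, hence elementary because \<open>\<K>\<close> is strong, and fixes \<open>A \<union> B\<close> pointwise, so it must
  fix \<open>c\<close>.\<close>

section \<open>Definable and algebraic closure\<close>

text \<open>Strongness of \<K> applies only to isomorphisms between members of \<K>, so the
  automorphism of \<open>E\<close> is used as it stands and never has to be extended to M. The price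
  is that \<open>E\<close> must be shown definably closed, which \<open>dcl_acl\<close> does by
  manipulating formulas. Hypothesis 2 says that elements of C independent over C^p stay independent
  over M^p, whereas a vanishing derivative of the minimal polynomial of x produces a relation with
  coefficients in C between powers of x^p, which lie in M^p. Linear disjointness therefore has to be
  turned around. Characteristic 0 runs along with characteristic p, because \<open>p dvd n\<close>
  then means n = 0. The separability in Hypothesis 2 and the closures and automorphisms in
  Hypothesis 3 refer to the operations of \<open>M\<^sub>0\<close>, while minimal polynomials split
  over M. So the field theory is done in \<open>ring_of M\<close>, and the hypotheses are carried
  over along the inclusion.\<close>

lemma tm_val_cong: "(\<And>i. i \<in> tm_fv t \<Longrightarrow> e i = e' i) \<Longrightarrow> tm_val M e t = tm_val M e' t"
proof (induct t)
  case (App g ts)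
  then have "map (tm_val M e) ts = map (tm_val M e') ts" by (auto intro!: map_cong)
  then show ?case by (simp del: map_eq_conv)
qed simp

lemma sat_cong: "(\<And>i. i \<in> fv \<phi> \<Longrightarrow> e i = e' i) \<Longrightarrow> sat M e \<phi> \<longleftrightarrow> sat M e' \<phi>"
proof (induct \<phi> arbitrary: e e')
  case (Eq s t)
  then show ?case using tm_val_cong[of s e e' M] tm_val_cong[of t e e' M] by simp
next
  case (Rel r ts)
  then have "map (tm_val M e) ts = map (tm_val M e') ts"
    by (auto intro!: map_cong tm_val_cong)
  then show ?case by (simp del: map_eq_conv)
next
  case (Neg \<phi>)
  then have "sat M e \<phi> \<longleftrightarrow> sat M e' \<phi>" by (intro Neg.hyps) simp
  then show ?case by simp
next
  case (And \<phi> \<psi>)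
  have "sat M e \<phi> \<longleftrightarrow> sat M e' \<phi>" using And.prems by (intro And.hyps(1)) simp
  moreover have "sat M e \<psi> \<longleftrightarrow> sat M e' \<psi>" using And.prems by (intro And.hyps(2)) simp
  ultimately show ?case by simp
next
  case (Ex i \<phi>)
  have "sat M (e(i := a)) \<phi> \<longleftrightarrow> sat M (e'(i := a)) \<phi>" for a
    using Ex.prems by (intro Ex.hyps) auto
  then show ?case by simp
qed

lemma finite_tm_fv: "finite (tm_fv t)"
  by (induct t) auto

lemma finite_fv: "finite (fv \<phi>)"
  by (induct \<phi>) (auto simp: finite_tm_fv)

section \<open>Renaming of variables\<close>

fun tm_rename :: "(nat \<Rightarrow> nat) \<Rightarrow> 'f tm \<Rightarrow> 'f tm" where
  "tm_rename \<pi> (Var i) = Var (\<pi> i)"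
| "tm_rename \<pi> (App g ts) = App g (map (tm_rename \<pi>) ts)"

text \<open>Bound variables are renamed along with the free ones, so that an injective renaming
  cannot capture variables.\<close>

fun fm_rename :: "(nat \<Rightarrow> nat) \<Rightarrow> ('f, 'r) fm \<Rightarrow> ('f, 'r) fm" where
  "fm_rename \<pi> (Eq s t) = Eq (tm_rename \<pi> s) (tm_rename \<pi> t)"
| "fm_rename \<pi> (Rel r ts) = Rel r (map (tm_rename \<pi>) ts)"
| "fm_rename \<pi> (Neg \<phi>) = Neg (fm_rename \<pi> \<phi>)"
| "fm_rename \<pi> (And \<phi> \<psi>) = And (fm_rename \<pi> \<phi>) (fm_rename \<pi> \<psi>)"
| "fm_rename \<pi> (Ex i \<phi>) = Ex (\<pi> i) (fm_rename \<pi> \<phi>)"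

lemma tm_wf_rename: "tm_wf L (tm_rename \<pi> t) \<longleftrightarrow> tm_wf L t"
  by (induct t) auto

lemma fm_wf_rename: "fm_wf L (fm_rename \<pi> \<phi>) \<longleftrightarrow> fm_wf L \<phi>"
  by (induct \<phi>) (auto simp: tm_wf_rename)

lemma tm_fv_rename: "tm_fv (tm_rename \<pi> t) = \<pi> ` tm_fv t"
  by (induct t) auto

lemma fv_rename: "inj \<pi> \<Longrightarrow> fv (fm_rename \<pi> \<phi>) = \<pi> ` fv \<phi>"
  by (induct \<phi>) (auto simp: tm_fv_rename image_set_diff)

lemma tm_val_rename: "tm_val M e (tm_rename \<pi> t) = tm_val M (\<lambda>i. e (\<pi> i)) t"
proof (induct t)
  case (App g ts)
  then have "map (\<lambda>t. tm_val M e (tm_rename \<pi> t)) ts = map (tm_val M (\<lambda>i. e (\<pi> i))) ts"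
    by (intro map_cong) auto
  then show ?case by (simp add: comp_def del: map_eq_conv)
qed simp

lemma sat_rename:
  assumes "inj \<pi>"
  shows "sat M e (fm_rename \<pi> \<phi>) \<longleftrightarrow> sat M (\<lambda>i. e (\<pi> i)) \<phi>"
proof (induct \<phi> arbitrary: e)
  case (Ex i \<phi>)
  have "(\<lambda>k. (e(\<pi> i := a)) (\<pi> k)) = (\<lambda>k. e (\<pi> k))(i := a)" for a
    using assms by (auto simp: fun_eq_iff inj_eq)
  then show ?case using Ex by simp
qed (auto simp: tm_val_rename comp_def)

section \<open>Definable and algebraic closure in terms of satisfaction\<close>

lemma holds_singleton: "holds M [x] \<psi> \<longleftrightarrow> sat M ((snd \<psi>)(0 := x)) (fst \<psi>)"
proof -
  have "(\<lambda>i. if i < length [x] then [x] ! i else snd \<psi> i) = (snd \<psi>)(0 := x)"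
    by auto
  then show ?thesis unfolding holds_def by simp
qed

lemma pformulas_1_iff:
  "(\<phi>, e) \<in> pformulas L 1 A \<longleftrightarrow> fm_wf L \<phi> \<and> (\<forall>i\<in>fv \<phi> - {0}. e i \<in> A)"
  unfolding pformulas_def lformulas_def by (auto simp: Suc_le_eq)

lemma acl_iff:
  "c \<in> acl L M A \<longleftrightarrow> c \<in> univ M \<and> (\<exists>\<phi> e. fm_wf L \<phi> \<and> (\<forall>i\<in>fv \<phi> - {0}. e i \<in> A) \<and>
     finite {x \<in> univ M. sat M (e(0 := x)) \<phi>} \<and> sat M (e(0 := c)) \<phi>)"
  by (simp only: acl_def mem_Collect_eq Bex_def split_paired_Ex pformulas_1_iff holds_singleton
      fst_conv snd_conv conj_assoc)

lemma dcl_iff: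
  "c \<in> dcl L M A \<longleftrightarrow> c \<in> univ M \<and> (\<exists>\<phi> e. fm_wf L \<phi> \<and> (\<forall>i\<in>fv \<phi> - {0}. e i \<in> A) \<and>
     {x \<in> univ M. sat M (e(0 := x)) \<phi>} = {c})"
  by (simp only: dcl_def mem_Collect_eq Bex_def split_paired_Ex pformulas_1_iff holds_singleton
      fst_conv snd_conv conj_assoc)

lemma acl_mono: "A \<subseteq> B \<Longrightarrow> acl L M A \<subseteq> acl L M B"
proof
  fix c assume "A \<subseteq> B" "c \<in> acl L M A"
  then show "c \<in> acl L M B" unfolding acl_iff by (meson subsetD)
qed

lemma dcl_subset_acl: "dcl L M A \<subseteq> acl L M A"
proof
  fix c assume "c \<in> dcl L M A"
  then obtain \<phi> e where *: "c \<in> univ M" "fm_wf L \<phi>" "\<forall>i\<in>fv \<phi> - {0}. e i \<in> A"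
    "{x \<in> univ M. sat M (e(0 := x)) \<phi>} = {c}" unfolding dcl_iff by auto
  then have "sat M (e(0 := c)) \<phi>" by blast
  then show "c \<in> acl L M A" unfolding acl_iff using * by (intro conjI exI[of _ \<phi>] exI[of _ e]) auto
qed

lemma subset_dcl:
  assumes "A \<subseteq> univ M"
  shows "A \<subseteq> dcl L M A"
proof
  fix a assume "a \<in> A"
  then show "a \<in> dcl L M A"
    unfolding dcl_iff using assms
    by (intro conjI exI[of _ "Eq (Var 0) (Var (Suc 0))"] exI[of _ "\<lambda>_. a"]) auto
qed

text \<open>The parameters algebraic over \<open>C\<close>, at the variables in \<open>J\<close>, are quantified away one at a
  time. The formula must have finitely many solutions for every value of these parameters, since the
  conjugates of a parameter do not have to behave like the parameter itself.\<close>

lemma acl_transitive_aux: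
  assumes "finite J" "0 \<notin> J" "fm_wf L \<theta>"
    "\<And>i. i \<in> fv \<theta> \<Longrightarrow> i \<noteq> 0 \<Longrightarrow> i \<notin> J \<Longrightarrow> e i \<in> C"
    "\<And>i. i \<in> J \<Longrightarrow> e i \<in> acl L M C"
    "\<And>e'. (\<And>i. i \<notin> J \<Longrightarrow> e' i = e i) \<Longrightarrow> (\<And>i. i \<in> J \<Longrightarrow> e' i \<in> univ M) \<Longrightarrow>
       finite {x \<in> univ M. sat M (e'(0 := x)) \<theta>}"
    "c \<in> univ M" "sat M (e(0 := c)) \<theta>"
  shows "c \<in> acl L M C"
  using assms
proof (induct J arbitrary: \<theta> e rule: finite_induct)
  case empty
  have "finite {x \<in> univ M. sat M (e(0 := x)) \<theta>}"
    by (rule empty.prems(5)) simp_all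
  moreover have "\<forall>i\<in>fv \<theta> - {0}. e i \<in> C" using empty.prems(3) by simp
  ultimately show ?case
    unfolding acl_iff using empty.prems(2,6,7) by blast
next
  case (insert j J)
  have j0: "j \<noteq> 0" using insert.prems(1) by simp
  obtain \<psi> d where \<psi>: "fm_wf L \<psi>" "\<And>i. i \<in> fv \<psi> \<Longrightarrow> i \<noteq> 0 \<Longrightarrow> d i \<in> C"
    "finite {y \<in> univ M. sat M (d(0 := y)) \<psi>}" "sat M (d(0 := e j)) \<psi>" and ej: "e j \<in> univ M"
    using insert.prems(4)[of j] unfolding acl_iff by auto
  define D where "D = {y \<in> univ M. sat M (d(0 := y)) \<psi>}"
  have "finite (fv \<theta> \<union> insert j J)" using finite_fv insert.hyps(1) by simp
  then have "\<exists>N. \<forall>i\<in>fv \<theta> \<union> insert j J. i < N" by (rule iffD1[OF finite_nat_set_iff_bounded])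
  then obtain N where "\<forall>i\<in>fv \<theta> \<union> insert j J. i < N" by (rule exE)
  then have N: "i < N" if "i \<in> fv \<theta> \<union> insert j J" for i using that by (rule bspec)
  \<comment> \<open>The object variable of \<psi> becomes \<open>j\<close>, and its parameters move
    to indices above \<open>N\<close>, beyond everything that \<theta> and the parameter set use. A
    single assignment \<open>e1\<close> can then carry the parameters of both formulas.\<close>
  define \<pi> where "\<pi> i = (if i = 0 then j else i + N)" for i
  have jN: "j < N" using N by simp
  then have inj: "inj \<pi>" by (auto simp: inj_def \<pi>_def)
  define \<psi>' where "\<psi>' = fm_rename \<pi> \<psi>"
  define e1 where "e1 i = (if i < N then e i else d (i - N))" for i
  have sat_\<psi>': "sat M f \<psi>' \<longleftrightarrow> sat M (d(0 := f j)) \<psi>"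
    if "\<And>i. N < i \<Longrightarrow> f i = d (i - N)" for f
    unfolding \<psi>'_def sat_rename[OF inj] using that by (intro sat_cong) (auto simp: \<pi>_def)
  show ?case
  proof (rule insert.hyps(3)[of "Ex j (And \<psi>' \<theta>)" e1])
    show "0 \<notin> J" using insert.prems(1) by simp
    show "fm_wf L (Ex j (And \<psi>' \<theta>))" using insert.prems(2) \<psi>(1) by (simp add: \<psi>'_def fm_wf_rename)
    show "c \<in> univ M" by fact
    show "e1 i \<in> acl L M C" if "i \<in> J" for i
      using that insert.prems(4) N[of i] by (simp add: e1_def)
    show "e1 i \<in> C" if i: "i \<in> fv (Ex j (And \<psi>' \<theta>))" "i \<noteq> 0" "i \<notin> J" for i
    proof (cases "i \<in> fv \<theta>")
      case True
      then show ?thesis using i insert.prems(3) N[of i] by (simp add: e1_def)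
    next
      case False
      then obtain k where "k \<in> fv \<psi>" "i = \<pi> k" "i \<noteq> j"
        using i(1) by (auto simp: \<psi>'_def fv_rename[OF inj])
      then show ?thesis using \<psi>(2)[of k] by (auto simp: \<pi>_def e1_def split: if_splits)
    qed
    \<comment> \<open>The solutions lie in a union, over the solutions \<open>a\<close> of \<psi> in
      \<open>D\<close>, of solution sets of \<theta> with \<open>a\<close> at \<open>j\<close>. The
      parameters of \<psi> are in \<open>C\<close>, so the finite set \<open>D\<close> is the same
      for every \<open>e'\<close>.\<close>
    show "finite {x \<in> univ M. sat M (e'(0 := x)) (Ex j (And \<psi>' \<theta>))}"
      if e': "\<And>i. i \<notin> J \<Longrightarrow> e' i = e1 i" "\<And>i. i \<in> J \<Longrightarrow> e' i \<in> univ M" for e'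
    proof -
      have JN: "i \<notin> J" if "N \<le> i" for i using N[of i] that by auto
      have "finite {x \<in> univ M. sat M (e'(0 := x, j := a)) \<theta>}" if "a \<in> univ M" for a
      proof -
        \<comment> \<open>The finiteness assumption on \<theta> concerns assignments agreeing with
          \<open>e\<close> outside \<open>insert j J\<close>, whereas \<open>e'\<close> carries the
          parameters of \<psi> above \<open>N\<close>. Restoring \<open>e\<close> there does not
          affect \<theta>.\<close>
        define e2 where "e2 i = (if i < N then (e'(j := a)) i else e i)" for i
        have "sat M (e'(0 := x, j := a)) \<theta> \<longleftrightarrow> sat M (e2(0 := x)) \<theta>" for x
          using N j0 by (intro sat_cong) (auto simp: e2_def)
        moreover have "finite {x \<in> univ M. sat M (e2(0 := x)) \<theta>}"
          using N e' that by (intro insert.prems(5)) (auto simp: e2_def e1_def)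
        ultimately show ?thesis by simp
      qed
      then have "finite (\<Union>a\<in>D. {x \<in> univ M. sat M (e'(0 := x, j := a)) \<theta>})"
        using \<psi>(3) unfolding D_def by auto
      moreover have "sat M (e'(0 := x, j := a)) \<psi>' \<longleftrightarrow> sat M (d(0 := a)) \<psi>" for x a
        by (subst sat_\<psi>') (use e'(1) JN jN in \<open>auto simp: e1_def\<close>)
      then have "{x \<in> univ M. sat M (e'(0 := x)) (Ex j (And \<psi>' \<theta>))} \<subseteq>
          (\<Union>a\<in>D. {x \<in> univ M. sat M (e'(0 := x, j := a)) \<theta>})"
        unfolding D_def by auto
      ultimately show ?thesis by (rule rev_finite_subset)
    qed
    have "sat M (e1(0 := c, j := e j)) \<psi>'"
      by (subst sat_\<psi>') (use \<psi>(4) jN in \<open>auto simp: e1_def\<close>)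
    moreover have "sat M (e1(0 := c, j := e j)) \<theta> \<longleftrightarrow> sat M (e(0 := c)) \<theta>"
      using N j0 by (intro sat_cong) (auto simp: e1_def)
    ultimately show "sat M (e1(0 := c)) (Ex j (And \<psi>' \<theta>))"
      using insert.prems(7) ej by auto
  qed
qed

text \<open>A formula defining c from algebraic parameters may have infinitely many solutions once
  these parameters are varied. Adding the clause that the solution is unique leaves at most one
  solution for all parameter values, as \<open>acl_transitive_aux\<close> requires. This is what
  brings \<open>acl(C)\<close> under Hypothesis 1.\<close>

lemma dcl_acl: "dcl L M (acl L M C) = acl L M C"
proof
  show "acl L M C \<subseteq> dcl L M (acl L M C)"
    by (rule subset_dcl) (auto simp: acl_iff)
  show "dcl L M (acl L M C) \<subseteq> acl L M C"
  proof
    fix c assume "c \<in> dcl L M (acl L M C)"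
    then obtain \<phi> e where \<phi>: "c \<in> univ M" "fm_wf L \<phi>" "\<And>i. i \<in> fv \<phi> \<Longrightarrow> i \<noteq> 0 \<Longrightarrow> e i \<in> acl L M C"
      "{x \<in> univ M. sat M (e(0 := x)) \<phi>} = {c}" unfolding dcl_iff by auto
    have "finite (insert 0 (fv \<phi>))" by (simp add: finite_fv)
    then obtain k where k: "k \<notin> insert 0 (fv \<phi>)" using infinite_UNIV_nat ex_new_if_finite by blast
    define \<pi> where "\<pi> = transpose 0 k"
    have inj: "inj \<pi>" unfolding \<pi>_def by (rule inj_on_subset[OF inj_transpose]) simp
    \<comment> \<open>Swapping 0 with the fresh variable \<open>k\<close> turns \<phi> into the same
      condition on \<open>k\<close>, so \<theta> says that the value at 0 satisfies \<phi> and no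
      other value does.\<close>
    define \<theta> where "\<theta> = And \<phi> (Neg (Ex k (And (fm_rename \<pi> \<phi>) (Neg (Eq (Var 0) (Var k))))))"
    have swap: "sat M (f(k := a)) (fm_rename \<pi> \<phi>) \<longleftrightarrow> sat M (f(0 := a)) \<phi>" for f a
      unfolding sat_rename[OF inj] using k by (intro sat_cong) (auto simp: \<pi>_def transpose_def)
    have \<theta>: "sat M f \<theta> \<longleftrightarrow> sat M f \<phi> \<and> (\<forall>a\<in>univ M. sat M (f(0 := a)) \<phi> \<longrightarrow> a = f 0)" for f
      unfolding \<theta>_def using k by (auto simp: swap)
    have fv\<theta>: "fv \<theta> \<subseteq> insert 0 (fv \<phi>)"
      using fv_rename[OF inj, of \<phi>] unfolding \<theta>_def by (auto simp: \<pi>_def transpose_def split: if_splits)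
    show "c \<in> acl L M C"
    proof (rule acl_transitive_aux[of "fv \<phi> - {0}" L \<theta> e])
      show "fm_wf L \<theta>" using \<phi>(2) by (simp add: \<theta>_def fm_wf_rename)
      show "finite {x \<in> univ M. sat M (e'(0 := x)) \<theta>}" for e'
      proof (cases "\<exists>x\<in>univ M. sat M (e'(0 := x)) \<theta>")
        case True
        then obtain x where x: "x \<in> univ M" "sat M (e'(0 := x)) \<theta>" by (rule bexE)
        have "y = x" if y: "y \<in> univ M" "sat M (e'(0 := y)) \<theta>" for y
        proof -
          have "sat M (e'(0 := y)) \<phi>" using y(2) unfolding \<theta> by (rule conjunct1)
          then show ?thesis using x(2) y(1) unfolding \<theta> by simp
        qed
        then have "{x \<in> univ M. sat M (e'(0 := x)) \<theta>} \<subseteq> {x}" by (auto simp only: mem_Collect_eq singleton_iff)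
        then show ?thesis by (rule finite_subset) simp
      next
        case False
        then have "{x \<in> univ M. sat M (e'(0 := x)) \<theta>} = {}" by blast
        then show ?thesis by (simp only: finite.emptyI)
      qed
      have uniq: "sat M (e(0 := a)) \<phi> \<longleftrightarrow> a = c" if "a \<in> univ M" for a
        using \<phi>(4)[THEN eqset_imp_iff, of a] that by simp
      then show "sat M (e(0 := c)) \<theta>" using \<phi>(1) by (simp add: \<theta>)
      show "finite (fv \<phi> - {0})" using finite_fv by simp
      show "e i \<in> C" if "i \<in> fv \<theta>" "i \<noteq> 0" "i \<notin> fv \<phi> - {0}" for i
        using fv\<theta> that by blast
      show "e i \<in> acl L M C" if "i \<in> fv \<phi> - {0}" for i
        using \<phi>(3) that by simp
      show "c \<in> univ M" by (rule \<phi>(1))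
    qed simp
  qed
qed

text \<open>The formula defining c has its parameters in \<open>A\<close>, where f is the identity,
  so f c solves the same formula.\<close>

lemma elementary_map_fixes_dcl:
  assumes f: "elementary_map L M E f" "\<And>a. a \<in> A \<Longrightarrow> f a = a" and "A \<subseteq> E"
    and c: "c \<in> dcl L M A" "c \<in> E" "f c \<in> univ M"
  shows "f c = c"
proof -
  obtain \<phi> e where \<phi>: "fm_wf L \<phi>" "\<And>i. i \<in> fv \<phi> \<Longrightarrow> i \<noteq> 0 \<Longrightarrow> e i \<in> A"
    "{x \<in> univ M. sat M (e(0 := x)) \<phi>} = {c}" using c(1) unfolding dcl_iff by auto
  \<comment> \<open>Elementarity is stated for assignments with all values in \<open>E\<close>, so
    the variables carrying no parameter, 0 among them, receive c as a harmless value.\<close>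
  define e' where "e' i = (if i \<in> fv \<phi> \<and> i \<noteq> 0 then e i else c)" for i
  have "sat M (e(0 := c)) \<phi> \<longleftrightarrow> sat M e' \<phi>" by (intro sat_cong) (auto simp: e'_def)
  then have "sat M e' \<phi>" using \<phi>(3) by blast
  moreover have "range e' \<subseteq> E" using \<phi>(2) \<open>A \<subseteq> E\<close> c(2) by (auto simp: e'_def)
  ultimately have "sat M (f \<circ> e') \<phi>"
    using f(1) \<phi>(1) unfolding elementary_map_def lformulas_def by blast
  moreover have "sat M (f \<circ> e') \<phi> \<longleftrightarrow> sat M (e(0 := f c)) \<phi>"
    using f(2) \<phi>(2) by (intro sat_cong) (auto simp: e'_def)
  ultimately show ?thesis using \<phi>(3) c(3) by blast
qed

section \<open>The Frobenius homomorphism and linear disjointness\<close>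

text \<open>Induction by Pascal's rule. \<open>t\<close> holds the terms for exponent n, and
  \<open>u\<close> the same coefficients with one more factor y.\<close>

lemma (in cring) binomial:
  assumes x: "x \<in> carrier R" and y: "y \<in> carrier R"
  shows "(x \<oplus> y) [^] (n::nat) = (\<Oplus>k\<in>{..n}. [(n choose k)] \<cdot> (x [^] k \<otimes> y [^] (n - k)))"
proof (induction n)
  case 0
  show ?case by (simp add: x y)
next
  case (Suc n)
  define t where "t k = [(n choose k)] \<cdot> (x [^] k \<otimes> y [^] (n - k))" for k
  define u where "u k = [(n choose k)] \<cdot> (x [^] k \<otimes> y [^] (Suc n - k))" for k
  have t: "t \<in> A \<rightarrow> carrier R" and u: "u \<in> A \<rightarrow> carrier R" for A
    by (auto simp: t_def u_def x y)
  have tx: "x \<otimes> t k = [(n choose k)] \<cdot> (x [^] Suc k \<otimes> y [^] (Suc n - Suc k))" for k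
    using add_pow_rdistr[OF x, of "x [^] k \<otimes> y [^] (n - k)" "n choose k"] x y
    by (simp add: t_def m_ac)
  have ty: "y \<otimes> t k = u k" if "k \<le> n" for k
    using add_pow_rdistr[OF y, of "x [^] k \<otimes> y [^] (n - k)" "n choose k"] x y that
    by (simp add: t_def u_def m_ac Suc_diff_le)
  have "(x \<oplus> y) [^] Suc n = x \<otimes> (\<Oplus>k\<in>{..n}. t k) \<oplus> y \<otimes> (\<Oplus>k\<in>{..n}. t k)"
    using Suc x y t by (simp add: t_def[symmetric] m_comm r_distr l_distr)
  also have "y \<otimes> (\<Oplus>k\<in>{..n}. t k) = (\<Oplus>k\<in>{..n}. u k)"
    using y t u ty by (simp add: finsum_rdistr) (intro finsum_cong', auto)
  \<comment> \<open>The added term has coefficient \<open>n choose Suc n\<close>, which is 0; with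
    it the sum of \<open>u\<close> lines up with that of \<open>x \<otimes> t k\<close> after a
    shift of the index.\<close>
  also have "\<dots> = (\<Oplus>k\<in>{..Suc n}. u k)"
    using u by (simp add: u_def x y binomial_eq_0)
  also have "\<dots> = (\<Oplus>k\<in>{..n}. u (Suc k)) \<oplus> u 0"
    using u by (subst finsum_Suc2) auto
  also have "x \<otimes> (\<Oplus>k\<in>{..n}. t k) = (\<Oplus>k\<in>{..n}. x \<otimes> t k)"
    using x t by (simp add: finsum_rdistr)
  also have "(\<Oplus>k\<in>{..n}. x \<otimes> t k) \<oplus> ((\<Oplus>k\<in>{..n}. u (Suc k)) \<oplus> u 0) =
      (\<Oplus>k\<in>{..n}. x \<otimes> t k \<oplus> u (Suc k)) \<oplus> u 0"
    using x t u by (subst finsum_addf) (auto simp: a_assoc t_def u_def y)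
  also have "(\<Oplus>k\<in>{..n}. x \<otimes> t k \<oplus> u (Suc k)) =
      (\<Oplus>k\<in>{..n}. [(Suc n choose Suc k)] \<cdot> (x [^] Suc k \<otimes> y [^] (Suc n - Suc k)))"
    unfolding tx u_def using x y
    by (intro finsum_cong') (auto simp: add.nat_pow_mult)
  also have "\<dots> \<oplus> u 0 = (\<Oplus>k\<in>{..Suc n}. [(Suc n choose k)] \<cdot> (x [^] k \<otimes> y [^] (Suc n - k)))"
    using x y by (subst finsum_Suc2) (auto simp: u_def)
  finally show ?case .
qed

text \<open>The derivative and separability notions are defined for ring records without extra fields
  only, hence the type of \<open>R\<close>.\<close>

locale plain_field = field R for R :: "'a ring" (structure)

locale char_field = plain_field R for R :: "'a ring" (structure) +
  fixes p :: nat
  assumes char: "has_char R p" and char_prime: "p = 0 \<or> Factorial_Ring.prime p"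
begin

lemma add_pow_eq_zero_iff:
  assumes "a \<in> carrier R"
  shows "[n] \<cdot> a = \<zero> \<longleftrightarrow> p dvd n \<or> a = \<zero>"
  using assms add_pow_ldistr[of \<one> a n] integral_iff[of "[n] \<cdot> \<one>" a] char by (simp add: has_char_def)

lemma frobenius_ring_hom:
  assumes "p \<noteq> 0"
  shows "(\<lambda>x. x [^] p) \<in> ring_hom R R"
proof (rule ring_hom_memI)
  fix x y assume x: "x \<in> carrier R" and y: "y \<in> carrier R"
  have p: "Factorial_Ring.prime p" using char_prime assms by simp
  then have "1 < p" by (rule prime_gt_1_nat)
  \<comment> \<open>Writing p as m + 2 separates the outer terms k = 0 and k = p from the inner
    ones, which are \<open>Suc k\<close> for k \<le> m and have coefficients divisible by p.\<close>
  then obtain m where m: "p = Suc (Suc m)"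
    by (metis One_nat_def less_imp_Suc_add add_Suc)
  have z: "(\<Oplus>k\<in>{..m}. [(p choose Suc k)] \<cdot> (x [^] Suc k \<otimes> y [^] (p - Suc k))) = \<zero>"
  proof (intro add.finprod_one_eqI)
    fix k assume "k \<in> {..m}"
    then have "p dvd (p choose Suc k)"
      using m by (intro dvd_choose_prime p) auto
    then show "[(p choose Suc k)] \<cdot> (x [^] Suc k \<otimes> y [^] (p - Suc k)) = \<zero>"
      using x y add_pow_eq_zero_iff by auto
  qed
  have "(x \<oplus> y) [^] p = (\<Oplus>k\<in>{..Suc (Suc m)}. [(p choose k)] \<cdot> (x [^] k \<otimes> y [^] (p - k)))"
    unfolding binomial[OF x y] using m by simp
  also have "\<dots> = x [^] p \<oplus> (\<Oplus>k\<in>{..Suc m}. [(p choose k)] \<cdot> (x [^] k \<otimes> y [^] (p - k)))"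
    using x y m by (subst finsum_Suc) auto
  also have "(\<Oplus>k\<in>{..Suc m}. [(p choose k)] \<cdot> (x [^] k \<otimes> y [^] (p - k))) = y [^] p"
    using x y z by (subst finsum_Suc2) auto
  finally show "(x \<oplus> y) [^] p = x [^] p \<oplus> y [^] p" .
qed (auto simp: nat_pow_distrib)

end

section \<open>Linear disjointness is symmetric\<close>

lemma (in ring) subring_add_pow_closed:
  assumes "subring K R" "a \<in> K"
  shows "[(n::nat)] \<cdot> a \<in> K"
  using subringE[OF assms(1)] assms(2) by (induct n) auto

text \<open>Interchange of a double sum: the lists in \<open>ks\<close> are the rows of a matrix,
  and summing rows against \<open>us\<close> and then against \<open>fs\<close> equals summing
  columns against \<open>fs\<close> and then against \<open>us\<close>.\<close>

lemma (in cring) combine_combine: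
  assumes us: "set us \<subseteq> carrier R" and "set fs \<subseteq> carrier R" "length ks = length fs"
    and "\<And>k. k \<in> set ks \<Longrightarrow> set k \<subseteq> carrier R \<and> length k = length us"
  shows "combine (map (\<lambda>k. combine k us) ks) fs =
    combine (map (\<lambda>i. combine (map (\<lambda>k. k ! i) ks) fs) [0..<length us]) us"
  using assms(3,2,4)
proof (induction ks fs rule: list_induct2)
  case Nil
  have "map (\<lambda>i. \<zero>) [0..<length us] = replicate (length us) \<zero>"
    by (simp add: map_replicate_const)
  then show ?case using combine_replicate[OF us] by simp
next
  case (Cons k ks f fs)
  let ?g = "\<lambda>i. combine (map (\<lambda>k. k ! i) ks) fs"
  have k: "set k \<subseteq> carrier R" "length k = length us" and f: "f \<in> carrier R" "set fs \<subseteq> carrier R"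
    using Cons.prems by auto
  have g: "?g i \<in> carrier R" if "i < length us" for i
    using Cons.prems f that by (intro combine_in_carrier) (fastforce simp: subset_iff)+
  have ki: "k ! i \<in> carrier R" if "i < length us" for i
    using k that by (simp add: subset_iff)
  have "combine k us \<otimes> f = combine (map ((\<otimes>) f) k) us"
    using k f us by (simp add: combine_r_distr m_comm)
  also have "map ((\<otimes>) f) k = map (\<lambda>i. k ! i \<otimes> f) [0..<length us]"
    using k f ki by (intro nth_equalityI) (auto simp: m_comm)
  finally have "combine (map (\<lambda>k. combine k us) (k # ks)) (f # fs) =
      combine (map (\<lambda>i. k ! i \<otimes> f) [0..<length us]) us \<oplus> combine (map ?g [0..<length us]) us"
    using Cons by simp
  also have "\<dots> = combine (map2 (\<oplus>) (map (\<lambda>i. k ! i \<otimes> f) [0..<length us]) (map ?g [0..<length us])) us"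
    using us g ki f by (intro combine_add) auto
  finally show ?case
    by (simp add: map2_map_map)
qed

text \<open>The coefficients of a relation over \<open>E\<close> are expanded in a basis of their span over \<open>K\<close>.\<close>

lemma (in field) linearly_disjoint_sym:
  assumes E: "subfield E R" and F: "subfield F R" and K: "subfield K R"
    and KE: "K \<subseteq> E" and KF: "K \<subseteq> F"
    and disj: "\<And>us. set us \<subseteq> E \<Longrightarrow> independent K us \<Longrightarrow> independent F us"
    and fs: "set fs \<subseteq> F" "independent K fs"
  shows "independent E fs"
proof (rule trivial_combine_imp_independent[OF E])
  show fsc: "set fs \<subseteq> carrier R"
    using fs subfieldE(3)[OF F] by auto
  fix as assume "set as \<subseteq> E" "combine as fs = \<zero>"
  \<comment> \<open>\<open>bs\<close> is \<open>as\<close> cut or padded with zeros to the length of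
    \<open>fs\<close>, as surplus coefficients are ignored by \<open>combine\<close>.\<close>
  then obtain bs where bs: "set (take (length fs) as) \<subseteq> set bs" "set bs \<subseteq> E"
    "length bs = length fs" "combine bs fs = \<zero>"
    using combine_normalize[of as fs \<zero>] fsc subfieldE(3)[OF E] subringE(2)[OF subfieldE(1)[OF E]]
      set_take_subset[of "length fs" as]
    by (smt (verit) Un_subset_iff dual_order.trans empty_subsetI insert_subset)
  have bsc: "set bs \<subseteq> carrier R" using bs subfieldE(3)[OF E] by auto
  obtain us where us: "set us \<subseteq> carrier R" "independent K us" "Span K us = Span K bs"
    using filter_base[OF K bsc] by blast
  have "set us \<subseteq> Span K bs" using Span_base_incl[OF K us(1)] us(3) by simp
  also have "\<dots> \<subseteq> E"
    using bs(2) bsc KE subringE(2,6,7)[OF subfieldE(1)[OF E]]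
    unfolding Span_eq_combine_set[OF K bsc]
  proof safe
    fix ks assume "set ks \<subseteq> K"
    then show "combine ks bs \<in> E"
      using bs(2) KE subringE(2,6,7)[OF subfieldE(1)[OF E]]
      by (induct ks bs rule: combine.induct) auto
  qed
  finally have indep: "independent F us" using disj us(2) by simp
  have "\<exists>k. set k \<subseteq> K \<and> length k = length us \<and> b = combine k us" if "b \<in> set bs" for b
    using Span_base_incl[OF K bsc] that us(3) Span_mem_iff_length_version[OF K us(1)] by blast
  then obtain k where k: "\<And>b. b \<in> set bs \<Longrightarrow> set (k b) \<subseteq> K \<and> length (k b) = length us \<and> b = combine (k b) us"
    by metis
  have Kc: "K \<subseteq> carrier R" by (rule subfieldE(3)[OF K])
  \<comment> \<open>Regrouped by basis elements, the relation becomes one among \<open>us\<close>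
    whose coefficients \<open>?c\<close> lie in F. These vanish because \<open>us\<close> stays
    independent over F. Each of them is a combination of \<open>fs\<close> over K, so its
    coefficients vanish in turn.\<close>
  let ?c = "map (\<lambda>i. combine (map (\<lambda>k. k ! i) (map k bs)) fs) [0..<length us]"
  have "map (\<lambda>k. combine k us) (map k bs) = bs"
    using k by (simp add: map_idI)
  then have "combine ?c us = \<zero>"
    using combine_combine[OF us(1) fsc, of "map k bs"] bs(3,4) k Kc by fastforce
  moreover have ki: "set (map (\<lambda>k. k ! i) (map k bs)) \<subseteq> K" if "i < length us" for i
    using k that by (auto simp: subset_iff)
  have "set ?c \<subseteq> F"
  proof -
    have "combine l fs \<in> F" if "set l \<subseteq> K" for l
      using that fs(1) KF subringE(2,6,7)[OF subfieldE(1)[OF F]]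
      by (induct l fs rule: combine.induct) auto
    then show ?thesis using ki by auto
  qed
  ultimately have "set (take (length us) ?c) \<subseteq> {\<zero>}"
    using independent_imp_trivial_combine[OF F indep] by blast
  then have c0: "combine (map (\<lambda>k. k ! i) (map k bs)) fs = \<zero>" if "i < length us" for i
    using that by (auto simp: image_subset_iff)
  have "set (take (length fs) (map (\<lambda>k. k ! i) (map k bs))) \<subseteq> {\<zero>}" if "i < length us" for i
    using independent_imp_trivial_combine[OF K fs(2) ki[OF that] c0[OF that]] .
  then have "k b ! i = \<zero>" if "i < length us" "b \<in> set bs" for i b
    using that bs(3) by auto
  then have "k b = replicate (length us) \<zero>" if "b \<in> set bs" for b
    using that k by (intro nth_equalityI) auto
  then have "b = \<zero>" if "b \<in> set bs" for b
    using that k combine_replicate[OF us(1)] by metis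
  then show "set (take (length fs) as) \<subseteq> {\<zero>}" using bs(1) by blast
qed

section \<open>Derivatives and separability of minimal polynomials\<close>

context plain_field begin

lemma set_deriv_coeffs:
  assumes "subring K R" "set q \<subseteq> K"
  shows "set (deriv_coeffs R q) \<subseteq> K"
  using assms(2)
proof (induct q)
  case (Cons a q)
  then show ?case
    using subring_add_pow_closed[OF assms(1), of a "length q"] by (cases q) auto
qed simp

lemma length_deriv_coeffs: "length (deriv_coeffs R q) = length q - 1"
  by (induct R q rule: deriv_coeffs.induct) auto

lemma formal_deriv_in_carrier:
  assumes "subring K R" "q \<in> carrier (K[X])"
  shows "formal_deriv R q \<in> carrier (K[X])"
  unfolding formal_deriv_def univ_poly_carrier[symmetric]
  by (intro normalize_gives_polynomial set_deriv_coeffs[OF assms(1)] polynomial_incl)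
    (use assms(2) in \<open>simp add: univ_poly_carrier\<close>)

lemma eval_deriv_closed [simp]:
  "set q \<subseteq> carrier R \<Longrightarrow> x \<in> carrier R \<Longrightarrow> eval (deriv_coeffs R q) x \<in> carrier R"
  by (intro eval_in_carrier set_deriv_coeffs carrier_is_subring)

text \<open>The rules of differentiation are established for values at a point and for raw
  coefficient lists, which avoids normalising at every step.\<close>

lemma eval_deriv_Cons:
  "a \<in> carrier R \<Longrightarrow> x \<in> carrier R \<Longrightarrow> set q \<subseteq> carrier R \<Longrightarrow>
    eval (deriv_coeffs R (a # q)) x = [length q] \<cdot> a \<otimes> x [^] (length q - 1) \<oplus> eval (deriv_coeffs R q) x"
  by (cases q) (auto simp: length_deriv_coeffs simp del: add.nat_pow_Suc)

text \<open>Appending a zero coefficient is multiplication by X, so this is the product rule (Xq)' =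
  Xq' + q.\<close>

lemma eval_deriv_append_zero:
  "set q \<subseteq> carrier R \<Longrightarrow> x \<in> carrier R \<Longrightarrow>
    eval (deriv_coeffs R (q @ [\<zero>])) x = x \<otimes> eval (deriv_coeffs R q) x \<oplus> eval q x"
proof (induct q)
  case (Cons a q)
  then have *: "a \<in> carrier R" "set q \<subseteq> carrier R" "eval q x \<in> carrier R"
    "eval (deriv_coeffs R q) x \<in> carrier R"
    by (auto intro: eval_in_carrier)
  \<comment> \<open>For empty q the exponent \<open>length q - 1\<close> is truncated to 0, but the
    coefficient \<open>[length q] \<cdot> a\<close> is then zero.\<close>
  have "x \<otimes> ([length q] \<cdot> a \<otimes> x [^] (length q - 1)) = [length q] \<cdot> a \<otimes> x [^] length q"
    using * Cons.prems by (cases "length q") (auto simp: m_ac simp del: add.nat_pow_Suc)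
  then show ?case
    using Cons * eval_deriv_Cons[of a x "q @ [\<zero>]"] eval_deriv_Cons[of a x q]
    by (simp add: r_distr l_distr a_ac)
qed simp

lemma eval_deriv_replicate_append:
  "set q \<subseteq> carrier R \<Longrightarrow> x \<in> carrier R \<Longrightarrow>
    eval (deriv_coeffs R (replicate n \<zero> @ q)) x = eval (deriv_coeffs R q) x"
proof (induct n)
  case (Suc n)
  then have "set (replicate n \<zero> @ q) \<subseteq> carrier R" by auto
  then show ?case using Suc by (simp add: eval_deriv_Cons)
qed simp

lemma eval_deriv_normalize:
  "set q \<subseteq> carrier R \<Longrightarrow> x \<in> carrier R \<Longrightarrow>
    eval (deriv_coeffs R (normalize q)) x = eval (deriv_coeffs R q) x"
  using eval_deriv_replicate_append[OF normalize_in_carrier] normalize_def'[of q] by metis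

lemma set_map2_add:
  assumes "set q \<subseteq> carrier R" "set r \<subseteq> carrier R"
  shows "set (map2 (\<oplus>) q r) \<subseteq> carrier R"
  using assms by (fastforce dest: set_zip_leftD set_zip_rightD)

lemma eval_deriv_map2_add:
  "length q = length r \<Longrightarrow> set q \<subseteq> carrier R \<Longrightarrow> set r \<subseteq> carrier R \<Longrightarrow> x \<in> carrier R \<Longrightarrow>
    eval (deriv_coeffs R (map2 (\<oplus>) q r)) x = eval (deriv_coeffs R q) x \<oplus> eval (deriv_coeffs R r) x"
proof (induct q r rule: list_induct2)
  case (Cons a q b r)
  then have "set (map2 (\<oplus>) q r) \<subseteq> carrier R"
    by (intro set_map2_add) auto
  then show ?case
    using Cons by (simp add: eval_deriv_Cons add.nat_pow_distrib l_distr a_ac)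
qed simp

lemma eval_deriv_poly_add:
  assumes "set q \<subseteq> carrier R" "set r \<subseteq> carrier R" "x \<in> carrier R"
  shows "eval (deriv_coeffs R (poly_add q r)) x = eval (deriv_coeffs R q) x \<oplus> eval (deriv_coeffs R r) x"
proof -
  have *: "eval (deriv_coeffs R (poly_add q r)) x = eval (deriv_coeffs R q) x \<oplus> eval (deriv_coeffs R r) x"
    if "set q \<subseteq> carrier R" "set r \<subseteq> carrier R" "length r \<le> length q" for q r
  proof -
    let ?r = "replicate (length q - length r) \<zero> @ r"
    have r: "set ?r \<subseteq> carrier R" "length q = length ?r" using that by auto
    have "set (map2 (\<oplus>) q ?r) \<subseteq> carrier R"
      using that(1) r(1) by (rule set_map2_add)
    then show ?thesis
      using that assms(3) eval_deriv_map2_add[OF r(2) that(1) r(1) assms(3)]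
      by (simp add: eval_deriv_normalize eval_deriv_replicate_append)
  qed
  show ?thesis
  proof (cases "length r \<le> length q")
    case False
    then have "eval (deriv_coeffs R (poly_add r q)) x = eval (deriv_coeffs R r) x \<oplus> eval (deriv_coeffs R q) x"
      by (intro * assms) simp
    then show ?thesis
      unfolding poly_add_comm[OF assms(1,2)] using assms by (simp add: a_comm del: poly_add.simps)
  qed (rule *[OF assms(1,2)])
qed

lemma eval_deriv_smult:
  "c \<in> carrier R \<Longrightarrow> set q \<subseteq> carrier R \<Longrightarrow> x \<in> carrier R \<Longrightarrow>
    eval (deriv_coeffs R (map ((\<otimes>) c) q)) x = c \<otimes> eval (deriv_coeffs R q) x"
proof (induct q)
  case (Cons a q)
  then have "set (map ((\<otimes>) c) q) \<subseteq> carrier R" by auto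
  then show ?case
    using Cons add_pow_rdistr[of c a "length q"] m_assoc[of c "[length q] \<cdot> a" "x [^] (length q - 1)"]
    by (simp add: eval_deriv_Cons r_distr)
qed simp

text \<open>The product rule for (X - c)q: at c the term containing q' drops out. It follows that
  the derivative vanishes at a double root.\<close>

lemma eval_deriv_linear_mult:
  assumes q: "set q \<subseteq> carrier R" and c: "c \<in> carrier R"
  shows "eval (deriv_coeffs R (poly_mult [\<one>, \<ominus> c] q)) c = eval q c"
proof -
  have 1: "set (map ((\<otimes>) a) q) \<subseteq> carrier R" if "a \<in> carrier R" for a
    using q that by auto
  have 2: "set (poly_mult [\<ominus> c] q) \<subseteq> carrier R"
    using q c by (intro poly_mult_in_carrier) auto
  have "map ((\<otimes>) \<one>) q = q" using q by (simp add: map_idI subset_iff)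
  then have "eval (deriv_coeffs R (poly_mult [\<one>, \<ominus> c] q)) c =
      eval (deriv_coeffs R (q @ [\<zero>])) c \<oplus> eval (deriv_coeffs R (poly_mult [\<ominus> c] q)) c"
    using q c 2 by (simp add: eval_deriv_poly_add del: poly_add.simps)
  also have "eval (deriv_coeffs R (poly_mult [\<ominus> c] q)) c = (\<ominus> c) \<otimes> eval (deriv_coeffs R q) c"
    using q c 1[of "\<ominus> c"] by (simp add: eval_deriv_poly_add eval_deriv_smult del: poly_add.simps)
  also have "eval (deriv_coeffs R (q @ [\<zero>])) c = c \<otimes> eval (deriv_coeffs R q) c \<oplus> eval q c"
    using q c by (rule eval_deriv_append_zero)
  finally show ?thesis
    using q c eval_in_carrier[OF q c] eval_deriv_closed[OF q c] by algebra
qed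

text \<open>The Bezout coefficient of the derivative is read off from the inverse of its value at \<open>x\<close> in the
  field \<open>C[x]\<close>.\<close>

lemma separable_Irr:
  assumes C: "subfield C R" and x: "x \<in> carrier R" "(algebraic over C) x"
    and nz: "formal_deriv R (Irr C x) \<noteq> []"
  shows "separable_poly R (Irr C x)" "eval (formal_deriv R (Irr C x)) x \<noteq> \<zero>"
proof -
  let ?q = "Irr C x" and ?d = "formal_deriv R (Irr C x)"
  note sub = subfieldE(1)[OF C]
  interpret UP: domain "C[X]" by (rule univ_poly_is_domain[OF sub])
  interpret ev: ring_hom_ring "C[X]" R "\<lambda>q. eval q x" by (rule eval_ring_hom[OF sub x(1)])
  note q = IrrE[OF C x]
  have d: "?d \<in> carrier (C[X])" by (rule formal_deriv_in_carrier[OF sub q(1)])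
  show nz': "eval ?d x \<noteq> \<zero>"
  proof
    assume "eval ?d x = \<zero>"
    then have "degree ?q \<le> degree ?d"
      using pdivides_imp_degree_le[OF sub q(1) d nz] Irr_minimal[OF C x d] by blast
    moreover have "length ?d \<le> length ?q - 1"
      unfolding formal_deriv_def using normalize_length_le length_deriv_coeffs by metis
    ultimately show False
      using pirreducible_degree[OF C q(1,2)] by linarith
  qed
  have sf: "subfield (simple_extension C x) R"
    using simple_extension_is_subfield[OF C x(1)] x(2) by simp
  note img = simple_extension_as_eval_img[OF subfieldE(3)[OF C] x(1)]
  have "inv (eval ?d x) \<in> simple_extension C x"
    using subfield_m_inv(1)[OF sf, of "eval ?d x"] nz' d img by auto
  then obtain v where v: "v \<in> carrier (C[X])" "eval v x = inv (eval ?d x)"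
    using img by auto
  \<comment> \<open>The polynomial 1 - v q' vanishes at x, so the minimal polynomial divides it, and
    the cofactor is the other Bezout coefficient.\<close>
  define w where "w = \<one>\<^bsub>C[X]\<^esub> \<ominus>\<^bsub>C[X]\<^esub> (v \<otimes>\<^bsub>C[X]\<^esub> ?d)"
  have w: "w \<in> carrier (C[X])" unfolding w_def using v d by simp
  have "eval ?d x \<in> Units R" using nz' ev.hom_closed[OF d] field_Units by auto
  then have "eval w x = \<zero>"
    unfolding w_def a_minus_def using v d by (simp add: r_neg)
  then have "?q divides\<^bsub>C[X]\<^esub> w"
    using Irr_minimal[OF C x w] pdivides_iff_shell[OF C q(1) w] by blast
  then obtain u where u: "u \<in> carrier (C[X])" "w = ?q \<otimes>\<^bsub>C[X]\<^esub> u"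
    unfolding factor_def by blast
  have "(u \<otimes>\<^bsub>C[X]\<^esub> ?q) \<oplus>\<^bsub>C[X]\<^esub> (v \<otimes>\<^bsub>C[X]\<^esub> ?d) = w \<oplus>\<^bsub>C[X]\<^esub> (v \<otimes>\<^bsub>C[X]\<^esub> ?d)"
    using u q(1) by (simp add: UP.m_comm)
  also have "\<dots> = \<one>\<^bsub>C[X]\<^esub>"
    unfolding w_def a_minus_def using v d by (simp add: UP.a_assoc UP.l_neg)
  \<comment> \<open>The operations of the polynomial rings over C and over R are literally the same;
    only the carriers differ.\<close>
  finally have "(u \<otimes>\<^bsub>poly_ring R\<^esub> ?q) \<oplus>\<^bsub>poly_ring R\<^esub> (v \<otimes>\<^bsub>poly_ring R\<^esub> ?d) = \<one>\<^bsub>poly_ring R\<^esub>"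
    by (simp add: univ_poly_def)
  then show "separable_poly R ?q"
    unfolding separable_poly_def using u(1) v(1) q(1) carrier_polynomial_shell[OF sub] by blast
qed

text \<open>The cofactor r of X - x in the minimal polynomial has positive degree because x is not
  in C, and it splits along with its multiple. A root of r equal to x would be a double root, where
  the derivative vanishes.\<close>

lemma exists_other_root:
  assumes C: "subfield C R" and x: "x \<in> carrier R" "(algebraic over C) x" "x \<notin> C"
    and nz: "formal_deriv R (Irr C x) \<noteq> []" and splits: "splitted (Irr C x)"
  obtains y where "y \<in> carrier R" "y \<noteq> x" "eval (Irr C x) y = \<zero>"
proof -
  let ?q = "Irr C x"
  note q = IrrE[OF C x(1,2)] and sub = subfieldE(1)[OF C]
  interpret UP: domain "poly_ring R" by (rule univ_poly_is_domain[OF carrier_is_subring])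
  have qR: "?q \<in> carrier (poly_ring R)" by (rule carrier_polynomial_shell[OF sub q(1)])
  have qnz: "?q \<noteq> []" using pirreducibleE[OF sub q(1,2)] by blast
  have "degree ?q \<noteq> 1"
  proof
    assume "degree ?q = 1"
    then have "length ?q = Suc (Suc 0)" by simp
    then obtain a b where ab: "?q = [a, b]"
      by (metis (no_types, opaque_lifting) Suc_length_conv length_0_conv)
    then have b: "b \<in> C" "b \<in> carrier R" "a = \<one>"
      using q(1,3)[unfolded ab] subfieldE(3)[OF C] by (auto simp: univ_poly_carrier[symmetric] polynomial_def)
    then have "x \<oplus> b = \<zero>" using q(4)[unfolded ab] b x(1) by simp
    then have "x = \<ominus> b" using b(2) x(1) minus_equality by metis
    then show False using x(3) subringE(5)[OF sub b(1)] by simp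
  qed
  then have deg: "degree ?q \<ge> 2" using pirreducible_degree[OF C q(1,2)] by linarith
  have "is_root ?q x" unfolding is_root_def using x q qnz by simp
  then obtain r where r: "r \<in> carrier (poly_ring R)" "?q = [\<one>, \<ominus> x] \<otimes>\<^bsub>poly_ring R\<^esub> r"
    using is_root_imp_pdivides[OF qR] unfolding pdivides_def factor_def by blast
  have lin: "[\<one>, \<ominus> x] \<in> carrier (poly_ring R)"
    using x by (simp add: univ_poly_carrier[symmetric] polynomial_def)
  have rdvd: "r pdivides ?q"
    unfolding pdivides_def using r UP.m_comm[OF lin r(1)]
    by (metis lin dividesI)
  have rnz: "r \<noteq> []"
  proof
    assume "r = []"
    then have "r = \<zero>\<^bsub>poly_ring R\<^esub>" by (simp add: univ_poly_zero)
    then have "?q = \<zero>\<^bsub>poly_ring R\<^esub>" using r(2) lin UP.r_null by metis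
    then show False using qnz by (simp add: univ_poly_zero)
  qed
  have "degree ?q = 1 + degree r"
    using poly_mult_degree_eq[OF carrier_is_subring, of "[\<one>, \<ominus> x]" r] r(1) lin rnz
    unfolding r(2) univ_poly_carrier univ_poly_mult by (simp del: poly_mult.simps)
  moreover have "splitted r" using pdivides_imp_splitted[OF r(1) qR qnz splits rdvd] .
  ultimately have "roots r \<noteq> {#}" using deg unfolding splitted_def by auto
  then obtain y where "is_root r y" using roots_mem_iff_is_root[OF r(1)] by blast
  then have y: "y \<in> carrier R" "eval r y = \<zero>" by (auto simp: is_root_def)
  have "y \<noteq> x"
  proof
    assume "y = x"
    have rs: "set r \<subseteq> carrier R" using r(1) polynomial_incl univ_poly_carrier by blast
    have "eval (deriv_coeffs R ?q) x = \<zero>"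
      using eval_deriv_linear_mult[OF rs x(1)] y(2) unfolding r(2) univ_poly_mult \<open>y = x\<close> by metis
    then have "eval (formal_deriv R ?q) x = \<zero>"
      unfolding formal_deriv_def
      using eval_normalize[OF set_deriv_coeffs[OF carrier_is_subring polynomial_incl] x(1)] qR
      by (simp add: univ_poly_carrier)
    then show False using separable_Irr(2)[OF C x(1,2) nz] by simp
  qed
  moreover have "eval ?q y = \<zero>" using pdivides_imp_root_sharing[OF r(1) rdvd y(1)] y(2) .
  ultimately show ?thesis using that y(1) by blast
qed

end

section \<open>Minimal polynomials with vanishing derivative\<close>

lemma (in ring) normalize_eq_Nil: "normalize q = [] \<Longrightarrow> set q \<subseteq> {\<zero>}"
  by (induct q) (auto split: if_splits)

text \<open>Entry i of q belongs to the exponent \<open>length q - 1 - i\<close>. Keeping only the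
  entries with exponent divisible by p gives h with q(X) = h(X^p). Preserving the head keeps h monic
  when q is.\<close>

lemma (in cring) exists_power_substitution:
  assumes "p \<noteq> 0" "set q \<subseteq> carrier R" "length q = p * m + 1"
    "\<And>i. i < length q \<Longrightarrow> \<not> p dvd (length q - 1 - i) \<Longrightarrow> q ! i = \<zero>"
  shows "\<exists>h. length h = m + 1 \<and> hd h = hd q \<and> set h \<subseteq> set q \<and>
    (\<forall>x\<in>carrier R. eval h (x [^] p) = eval q x)"
  using assms(2-)
proof (induct m arbitrary: q)
  case 0
  then obtain a where q: "q = [a]" by (cases q) auto
  then show ?case by (intro exI[of _ q]) auto
next
  case (Suc m)
  let ?q = "drop p q"
  obtain a r where q: "q = a # r" using Suc.prems by (cases q) auto
  have z: "q ! i = \<zero>" if "0 < i" "i < p" for i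
  proof (rule Suc.prems)
    show "i < length q" using that Suc.prems by simp
    have "length q - 1 - i = p * m + (p - i)" using that Suc.prems by simp
    moreover have "\<not> p dvd (p - i)" using that by (intro nat_dvd_not_less) auto
    ultimately show "\<not> p dvd (length q - 1 - i)"
      by (metis dvd_add_right_iff dvd_triv_left)
  qed
  \<comment> \<open>Each block of p coefficients consists of one surviving coefficient followed by p
    - 1 zeros; dropping it lowers the degree by p.\<close>
  have take: "take p q = a # replicate (p - 1) \<zero>"
  proof (rule nth_equalityI)
    show "length (take p q) = length (a # replicate (p - 1) \<zero>)"
      using Suc.prems \<open>p \<noteq> 0\<close> by simp
    fix i assume "i < length (take p q)"
    then show "take p q ! i = (a # replicate (p - 1) \<zero>) ! i"
      using z[of i] q by (cases i) auto
  qed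
  have sub: "set ?q \<subseteq> set q" by (rule set_drop_subset)
  have "\<exists>h. length h = m + 1 \<and> hd h = hd ?q \<and> set h \<subseteq> set ?q \<and>
    (\<forall>x\<in>carrier R. eval h (x [^] p) = eval ?q x)"
  proof (rule Suc.hyps)
    show "set ?q \<subseteq> carrier R" using sub Suc.prems by blast
    show "length ?q = p * m + 1" using Suc.prems by simp
    fix i assume i: "i < length ?q" "\<not> p dvd (length ?q - 1 - i)"
    have "length q - 1 - (p + i) = length ?q - 1 - i" by simp
    then show "?q ! i = \<zero>" using Suc.prems(3)[of "p + i"] i by simp
  qed
  then obtain h where h: "length h = m + 1" "set h \<subseteq> set ?q"
    "\<And>x. x \<in> carrier R \<Longrightarrow> eval h (x [^] p) = eval ?q x" by blast
  have "eval (a # h) (x [^] p) = eval q x" if x: "x \<in> carrier R" for x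
  proof -
    have a: "a \<in> carrier R" using q Suc.prems by simp
    have "eval (replicate (p - 1) \<zero>) x = \<zero>"
      using eval_replicate[of "[]" x "p - 1"] x by simp
    then have "eval (take p q) x = a \<otimes> x [^] (p - 1)" using take a x by simp
    then have "eval (take p q @ ?q) x = a \<otimes> x [^] (p - 1) \<otimes> x [^] length ?q \<oplus> eval ?q x"
      using eval_append[of "take p q" ?q x] sub Suc.prems(1) x set_take_subset[of p q] by auto
    also have "a \<otimes> x [^] (p - 1) \<otimes> x [^] length ?q = a \<otimes> x [^] (p - 1 + length ?q)"
      using a x by (simp add: m_assoc nat_pow_mult)
    also have "p - 1 + length ?q = p * length h" using h Suc.prems \<open>p \<noteq> 0\<close> by simp
    finally show ?thesis using h(3) x by (simp add: nat_pow_pow)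
  qed
  then show ?case using h sub q by (intro exI[of _ "a # h"]) auto
qed

context char_field begin

lemma deriv_coeffs_zero_imp_nth_zero:
  assumes "set q \<subseteq> carrier R" "set (deriv_coeffs R q) \<subseteq> {\<zero>}" "i < length q"
    "\<not> p dvd (length q - 1 - i)"
  shows "q ! i = \<zero>"
  using assms
proof (induct q arbitrary: i)
  case (Cons a q)
  show ?case
  proof (cases i)
    case 0
    then have "q \<noteq> []" using Cons.prems by auto
    then have "[length q] \<cdot> a = \<zero>" using Cons.prems by (cases q) auto
    then show ?thesis using Cons.prems 0 add_pow_eq_zero_iff[of a "length q"] by simp
  next
    case (Suc j)
    then have "set (deriv_coeffs R q) \<subseteq> {\<zero>}" using Cons.prems by (cases q) auto
    then show ?thesis using Cons Suc by simp
  qed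
qed simp

text \<open>Otherwise the minimal polynomial is \<open>h(X^p)\<close>, so that some powers of \<open>x^p\<close> are dependent over \<open>C\<close>.
  By linear disjointness they are then dependent over \<open>C^p\<close>, and taking \<open>p\<close>-th roots contradicts the
  minimality of the degree.\<close>

lemma formal_deriv_Irr_nonzero:
  assumes C: "subfield C R" and x: "x \<in> carrier R" "(algebraic over C) x"
    and sep: "separable_ext R p (carrier R) C"
  shows "formal_deriv R (Irr C x) \<noteq> []"
proof
  let ?q = "Irr C x" and ?fr = "\<lambda>x. x [^] p"
  assume "formal_deriv R ?q = []"
  then have dz: "set (deriv_coeffs R ?q) \<subseteq> {\<zero>}"
    unfolding formal_deriv_def by (rule normalize_eq_Nil)
  note q = IrrE[OF C x] and sub = subfieldE(1)[OF C]
  have qC: "set ?q \<subseteq> C" using q(1) polynomial_incl univ_poly_carrier by blast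
  then have qs: "set ?q \<subseteq> carrier R" using subfieldE(3)[OF C] by blast
  have z: "?q ! i = \<zero>" if "i < length ?q" "\<not> p dvd (length ?q - 1 - i)" for i
    by (rule deriv_coeffs_zero_imp_nth_zero[OF qs dz that])
  have deg: "degree ?q \<ge> 1" using pirreducible_degree[OF C q(1,2)] .
  then have "?q \<noteq> []" by auto
  then have "?q ! 0 \<noteq> \<zero>" using q(3) by (simp add: hd_conv_nth)
  then have "p dvd degree ?q" using z[of 0] \<open>?q \<noteq> []\<close> by auto
  then obtain m where m: "degree ?q = p * m" by blast
  \<comment> \<open>In characteristic 0 the divisibility would already force degree 0.\<close>
  then have p0: "p \<noteq> 0" "m \<ge> 1"
    using deg by (metis mult_0 not_one_le_zero, metis mult_0_right less_one not_le)
  then have p: "Factorial_Ring.prime p" using char_prime by simp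
  then have "2 * m \<le> p * m" by (intro mult_le_mono1 prime_ge_2_nat)
  then have mdeg: "m + 1 \<le> degree ?q" using m p0(2) by linarith
  have "length ?q \<noteq> 0" using \<open>?q \<noteq> []\<close> by simp
  then have "length ?q = p * m + 1" using m by linarith
  then obtain h where h: "length h = m + 1" "hd h = \<one>" "set h \<subseteq> C" "eval h (?fr x) = \<zero>"
    using exists_power_substitution[OF p0(1) qs _ z] q(3,4) x(1) qC by (metis subset_trans)
  interpret fr: ring_hom_ring R R ?fr
    by (rule ring_hom_ringI2[OF ring_axioms ring_axioms frobenius_ring_hom[OF p0(1)]])
  note img = fr.img_is_subfield[OF _ one_not_zero]
  have CE: "?fr ` C \<subseteq> C"
  proof safe
    fix c assume "c \<in> C"
    then have "c [^] n \<in> C" for n :: nat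
      using subringE(3,6)[OF sub] by (induct n) auto
    then show "c [^] p \<in> C" .
  qed
  \<comment> \<open>Since m + 1 \<le> 2m \<le> pm, the powers of x up to m are among the independent
    powers below the degree of the minimal polynomial.\<close>
  have "independent C (exp_base x (m + 1))"
  proof -
    let ?k = "degree ?q - (m + 1)" and ?B = "exp_base x (degree ?q)"
    have "independent C (take ?k ?B @ drop ?k ?B)"
      using exp_base_independent[OF C x] by (simp only: append_take_drop_id)
    then have "independent C (drop ?k ?B)" by (rule independent_split(1)[OF C])
    then show ?thesis using mdeg by (simp only: drop_exp_base diff_diff_cancel)
  qed
  \<comment> \<open>Injectivity of Frobenius is the extraction of p-th roots: independence of powers
    of x over C gives that of powers of x^p over C^p.\<close>
  then have "independent (?fr ` C) (map ?fr (exp_base x (m + 1)))"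
    by (rule fr.inj_hom_preserves_independent[OF C one_not_zero, rotated])
      (rule inj_on_subset[OF img(1)[OF carrier_is_subfield]
        Span_in_carrier[OF subfieldE(3)[OF C] exp_base_closed[OF x(1)]]])
  moreover have "map ?fr (exp_base x n) = exp_base (?fr x) n" for n
    using x(1) by (simp add: exp_base_def nat_pow_pow mult.commute)
  ultimately have "independent (?fr ` C) (exp_base (?fr x) (m + 1))" by simp
  \<comment> \<open>Separability controls lists in C over M^p; its symmetric form controls the
    powers of x^p, a list in M^p, over C.\<close>
  then have "independent C (exp_base (?fr x) (m + 1))"
  proof (rule linearly_disjoint_sym[OF C img(2)[OF carrier_is_subfield] img(2)[OF C] CE, rotated -1])
    show "?fr ` C \<subseteq> ?fr ` carrier R" using subfieldE(3)[OF C] by blast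
    show "independent (?fr ` carrier R) us" if "set us \<subseteq> C" "independent (?fr ` C) us" for us
      using sep that p0(1) unfolding separable_ext_def linearly_disjoint_def by blast
    show "set (exp_base (?fr x) (m + 1)) \<subseteq> ?fr ` carrier R"
      unfolding \<open>\<And>n. map ?fr (exp_base x n) = exp_base (?fr x) n\<close>[symmetric]
      using exp_base_closed[OF x(1)] by auto
  qed
  then have "set (take (length (exp_base (?fr x) (m + 1))) h) \<subseteq> {\<zero>}"
    using independent_imp_trivial_combine[OF C _ h(3)] combine_eq_eval[of h "?fr x"] h(1,4) by metis
  then have "set h \<subseteq> {\<zero>}" using h(1) by (simp add: exp_base_def)
  moreover have "\<one> \<in> set h" using h(1,2) by (cases h) auto
  ultimately show False by auto
qed

end

section \<open>Automorphisms of normal extensions\<close>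

context ring_hom_ring begin

context
  assumes inj_zero: "\<And>a. a \<in> carrier R \<Longrightarrow> h a = \<zero>\<^bsub>S\<^esub> \<Longrightarrow> a = \<zero>"
begin

text \<open>Normalising strips leading zeros, so \<open>inj_zero\<close> is what prevents the map
  from creating new ones.\<close>

lemma map_normalize:
  "set q \<subseteq> carrier R \<Longrightarrow> map h (R.normalize q) = S.normalize (map h q)"
  using inj_zero by (induct q) auto

lemma map_poly_add:
  assumes "set q \<subseteq> carrier R" "set r \<subseteq> carrier R"
  shows "map h (R.poly_add q r) = S.poly_add (map h q) (map h r)"
proof -
  have *: "map h (R.poly_add q r) = S.poly_add (map h q) (map h r)"
    if le: "length r \<le> length q" and q: "set q \<subseteq> carrier R" and r: "set r \<subseteq> carrier R" for q r
  proof -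
    let ?r = "replicate (length q - length r) \<zero> @ r"
    have r': "set ?r \<subseteq> carrier R" using r by auto
    have qr: "a \<in> carrier R" "b \<in> carrier R" if "(a, b) \<in> set (zip q ?r)" for a b
      using set_zip_leftD[OF that] set_zip_rightD[OF that] q r' by blast+
    have "map h (map2 (\<oplus>) q ?r) = map2 (\<oplus>\<^bsub>S\<^esub>) (map h q) (map h ?r)"
      unfolding zip_map_map using qr by auto
    moreover have "set (map2 (\<oplus>) q ?r) \<subseteq> carrier R" using qr by auto
    ultimately show ?thesis using le by (simp add: map_normalize)
  qed
  show ?thesis
  proof (cases "length r \<le> length q")
    case False
    then have "map h (R.poly_add r q) = S.poly_add (map h r) (map h q)"
      by (intro * assms) simp
    then show ?thesis
      using False by simp
  qed (rule *[OF _ assms])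
qed

lemma map_poly_mult:
  assumes "set q \<subseteq> carrier R" "set r \<subseteq> carrier R"
  shows "map h (R.poly_mult q r) = S.poly_mult (map h q) (map h r)"
  using assms(1)
proof (induct q)
  case (Cons a q)
  let ?l = "map ((\<otimes>) a) r @ replicate (length q) \<zero>"
  have a: "a \<in> carrier R" "set q \<subseteq> carrier R" using Cons.prems by auto
  have "set ?l \<subseteq> carrier R" using a assms(2) by auto
  then have "map h (R.poly_mult (a # q) r) = S.poly_add (map h ?l) (map h (R.poly_mult q r))"
    using map_poly_add R.poly_mult_in_carrier[OF a(2) assms(2)]
    by (simp del: R.poly_add.simps S.poly_add.simps)
  also have "map h ?l = map ((\<otimes>\<^bsub>S\<^esub>) (h a)) (map h r) @ replicate (length q) \<zero>\<^bsub>S\<^esub>"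
    using a assms(2) by (auto simp: subset_iff)
  finally show ?case
    using Cons a by (simp del: R.poly_add.simps S.poly_add.simps)
qed simp

end

end

text \<open>Partial homomorphisms over \<open>C\<close> are represented by their graphs, for which unions of chains are
  plain unions. Closure under negatives and inverses is automatic because the domain is algebraic
  over \<open>C\<close>.\<close>

definition (in ring) partial_hom :: "'a set \<Rightarrow> ('a \<times> 'a) set \<Rightarrow> bool" where
  "partial_hom C G \<longleftrightarrow>
     G \<subseteq> {x \<in> carrier R. (algebraic over C) x} \<times> carrier R \<and> Id_on C \<subseteq> G \<and> single_valued G \<and>
     (\<forall>x u y v. (x, u) \<in> G \<longrightarrow> (y, v) \<in> G \<longrightarrow> (x \<oplus> y, u \<oplus> v) \<in> G \<and> (x \<otimes> y, u \<otimes> v) \<in> G)"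

lemma (in ring) partial_homD:
  assumes "partial_hom C G"
  shows "(x, u) \<in> G \<Longrightarrow> x \<in> carrier R" "(x, u) \<in> G \<Longrightarrow> u \<in> carrier R"
    "(x, u) \<in> G \<Longrightarrow> (algebraic over C) x" "c \<in> C \<Longrightarrow> (c, c) \<in> G"
    "(x, u) \<in> G \<Longrightarrow> (x, v) \<in> G \<Longrightarrow> u = v"
    "(x, u) \<in> G \<Longrightarrow> (y, v) \<in> G \<Longrightarrow> (x \<oplus> y, u \<oplus> v) \<in> G"
    "(x, u) \<in> G \<Longrightarrow> (y, v) \<in> G \<Longrightarrow> (x \<otimes> y, u \<otimes> v) \<in> G"
  using assms unfolding partial_hom_def single_valued_def by blast+

lemma (in ring) partial_hom_Union:
  assumes chain: "subset.chain (Collect (partial_hom C)) \<G>" and "\<G> \<noteq> {}"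
  shows "partial_hom C (\<Union>\<G>)"
proof -
  have G: "partial_hom C G" if "G \<in> \<G>" for G
    using chain that unfolding subset.chain_def by blast
  \<comment> \<open>Single-valuedness and closure each involve two pairs, and in a chain these lie
    in a common member.\<close>
  have two: "\<exists>G\<in>\<G>. a \<in> G \<and> b \<in> G" if "a \<in> \<Union>\<G>" "b \<in> \<Union>\<G>" for a b
    using chain that unfolding subset_chain_def by blast
  have "\<Union>\<G> \<subseteq> {x \<in> carrier R. (algebraic over C) x} \<times> carrier R"
    using partial_homD(1,2,3)[OF G] by auto
  moreover have "Id_on C \<subseteq> \<Union>\<G>"
    using partial_homD(4)[OF G] \<open>\<G> \<noteq> {}\<close> by blast
  moreover have "single_valued (\<Union>\<G>)"
  proof (rule single_valuedI)
    fix x u v assume "(x, u) \<in> \<Union>\<G>" "(x, v) \<in> \<Union>\<G>"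
    then obtain H where "H \<in> \<G>" "(x, u) \<in> H" "(x, v) \<in> H" using two by blast
    then show "u = v" using partial_homD(5)[OF G] by blast
  qed
  moreover have "(x \<oplus> y, u \<oplus> v) \<in> \<Union>\<G> \<and> (x \<otimes> y, u \<otimes> v) \<in> \<Union>\<G>"
    if xy: "(x, u) \<in> \<Union>\<G>" "(y, v) \<in> \<Union>\<G>" for x u y v
  proof -
    obtain H where H: "H \<in> \<G>" "(x, u) \<in> H" "(y, v) \<in> H" using two[OF xy] by blast
    then show ?thesis using partial_homD(6,7)[OF G[OF H(1)] H(2,3)] by blast
  qed
  ultimately show ?thesis unfolding partial_hom_def by blast
qed

section \<open>Extension of partial homomorphisms\<close>

context field begin

lemma partial_hom_subfield:
  assumes C: "subfield C R" and G: "partial_hom C G"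
  shows "subfield (Domain G) R"
proof (rule subfieldI')
  note sub = subfieldE(1)[OF C]
  note D = partial_homD[OF G]
  show K: "subring (Domain G) R"
  proof (rule subringI)
    show "Domain G \<subseteq> carrier R" using D(1) by blast
    show "\<one> \<in> Domain G" using D(4) subringE(3)[OF sub] by blast
    fix x assume "x \<in> Domain G"
    moreover have "\<ominus> \<one> \<in> C" using subringE(3,5)[OF sub] by blast
    ultimately have "\<ominus> \<one> \<otimes> x \<in> Domain G" "x \<in> carrier R" using D(1,4,7) by blast+
    then show "\<ominus> x \<in> Domain G" by (simp add: l_minus)
  qed (use D(6,7) in blast)+
  fix x assume x: "x \<in> Domain G - {\<zero>}"
  then have x': "x \<in> carrier R" "(algebraic over C) x" using D(1,3) by blast+
  \<comment> \<open>As x is algebraic, C[x] is already a field, and every subring containing C and x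
    contains it.\<close>
  have "inv x \<in> simple_extension C x"
    using subfield_m_inv(1)[of "simple_extension C x" x] simple_extension_is_subfield[OF C x'(1)]
      simple_extension_mem[OF sub x'(1)] x x'(2) by blast
  moreover have "C \<subseteq> Domain G" using D(4) by blast
  ultimately show "inv x \<in> Domain G"
    using simple_extension_subring_incl[OF K] x by blast
qed

lemma partial_hom_function:
  assumes C: "subfield C R" and G: "partial_hom C G"
  shows "\<exists>f\<in>ring_hom (R\<lparr>carrier := Domain G\<rparr>) R. (\<forall>c\<in>C. f c = c) \<and>
    (\<forall>x u. (x, u) \<in> G \<longleftrightarrow> x \<in> Domain G \<and> u = f x)"
proof -
  note D = partial_homD[OF G]
  define f where "f x = (SOME u. (x, u) \<in> G)" for x
  have f: "(x, f x) \<in> G" if "x \<in> Domain G" for x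
    using that unfolding f_def by (auto intro: someI)
  then have iff: "(x, u) \<in> G \<longleftrightarrow> x \<in> Domain G \<and> u = f x" for x u using D(5) by blast
  have C': "f c = c" if "c \<in> C" for c using D(4)[OF that] iff[of c c] by simp
  have "f \<in> ring_hom (R\<lparr>carrier := Domain G\<rparr>) R"
  proof (rule ring_hom_memI)
    show "f \<one>\<^bsub>R\<lparr>carrier := Domain G\<rparr>\<^esub> = \<one>"
      using C' subringE(3)[OF subfieldE(1)[OF C]] by simp
  next
    fix x assume "x \<in> carrier (R\<lparr>carrier := Domain G\<rparr>)"
    then show "f x \<in> carrier R" using f D(2) by fastforce
  next
    fix x y assume "x \<in> carrier (R\<lparr>carrier := Domain G\<rparr>)" "y \<in> carrier (R\<lparr>carrier := Domain G\<rparr>)"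
    then have "(x, f x) \<in> G" "(y, f y) \<in> G" using f by auto
    from D(6,7)[OF this] show
      "f (x \<otimes>\<^bsub>R\<lparr>carrier := Domain G\<rparr>\<^esub> y) = f x \<otimes> f y"
      "f (x \<oplus>\<^bsub>R\<lparr>carrier := Domain G\<rparr>\<^esub> y) = f x \<oplus> f y"
      using iff by auto
  qed
  then show ?thesis using C' iff by (intro bexI[of _ f]) simp_all
qed

lemma map_ring_hom:
  assumes K: "subfield K R" and f: "f \<in> ring_hom (R\<lparr>carrier := K\<rparr>) R"
  shows "map f \<in> ring_hom (K[X]) (poly_ring R)"
proof -
  note sub = subfieldE(1)[OF K]
  have KF: "field (R\<lparr>carrier := K\<rparr>)" by (rule subfield_iff(2)[OF K])
  interpret f: ring_hom_ring "R\<lparr>carrier := K\<rparr>" R f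
    by (rule ring_hom_ringI2[OF subring_is_ring[OF sub] ring_axioms f])
  have inj: "a = \<zero>\<^bsub>R\<lparr>carrier := K\<rparr>\<^esub>" if "a \<in> carrier (R\<lparr>carrier := K\<rparr>)" "f a = \<zero>" for a
    using non_trivial_field_hom_is_inj[OF f KF field_axioms] that f.hom_zero subringE(2)[OF sub]
    by (auto simp: inj_on_def)
  have set: "set q \<subseteq> K" if "q \<in> carrier (K[X])" for q
    using that polynomial_incl univ_poly_carrier by blast
  note consistent = univ_poly_consistent[OF sub]
  show ?thesis
  proof (rule ring_hom_memI)
    show "map f q \<in> carrier (poly_ring R)" if "q \<in> carrier (K[X])" for q
      using polynomial_hom[OF f KF field_axioms] that by (simp add: consistent)
    show "map f \<one>\<^bsub>K[X]\<^esub> = \<one>\<^bsub>poly_ring R\<^esub>"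
      using f.hom_one by (simp add: univ_poly_one)
    fix q r assume "q \<in> carrier (K[X])" "r \<in> carrier (K[X])"
    then have qr: "set q \<subseteq> carrier (R\<lparr>carrier := K\<rparr>)" "set r \<subseteq> carrier (R\<lparr>carrier := K\<rparr>)"
      using set by auto
    show "map f (q \<otimes>\<^bsub>K[X]\<^esub> r) = map f q \<otimes>\<^bsub>poly_ring R\<^esub> map f r"
      using f.map_poly_mult[OF inj qr]
      by (simp only: univ_poly_mult poly_mult_consistent[OF sub])
    show "map f (q \<oplus>\<^bsub>K[X]\<^esub> r) = map f q \<oplus>\<^bsub>poly_ring R\<^esub> map f r"
      using f.map_poly_add[OF inj qr]
      by (simp only: univ_poly_add poly_add_consistent[OF sub])
  qed
qed

text \<open>The extension sends q(x) to the value at y of the image of q under f. This is well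
  defined because a polynomial over the domain vanishing at x is a multiple of the minimal
  polynomial, whose image vanishes at y.\<close>

lemma partial_hom_extend_root:
  assumes C: "subfield C R" and G: "partial_hom C G"
    and f: "f \<in> ring_hom (R\<lparr>carrier := Domain G\<rparr>) R"
      "\<And>x u. (x, u) \<in> G \<longleftrightarrow> x \<in> Domain G \<and> u = f x"
    and x: "x \<in> carrier R" "(algebraic over C) x"
    and y: "y \<in> carrier R" "eval (map f (Irr (Domain G) x)) y = \<zero>"
  shows "\<exists>G'. partial_hom C G' \<and> G \<subseteq> G' \<and> (x, y) \<in> G'"
proof -
  define K where "K = Domain G"
  have K: "subfield K R" unfolding K_def by (rule partial_hom_subfield[OF C G])
  note sub = subfieldE(1)[OF K]
  note D = partial_homD[OF G]
  have CK: "C \<subseteq> K" using D(4) unfolding K_def by blast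
  interpret UP: domain "K[X]" by (rule univ_poly_is_domain[OF sub])
  have RX: "ring (poly_ring R)" by (rule univ_poly_is_ring[OF carrier_is_subring])
  have m: "map f \<in> ring_hom (K[X]) (poly_ring R)"
    by (rule map_ring_hom[OF K f(1)[folded K_def]])
  interpret ex: ring_hom_ring "K[X]" R "\<lambda>q. eval q x" by (rule eval_ring_hom[OF sub x(1)])
  interpret ey: ring_hom_ring "poly_ring R" R "\<lambda>q. eval q y"
    by (rule eval_ring_hom[OF carrier_is_subring y(1)])
  interpret map: ring_hom_ring "K[X]" "poly_ring R" "map f"
    by (rule ring_hom_ringI2[OF UP.ring_axioms RX m])
  have xK: "(algebraic over K) x" by (rule algebraic_mono[OF CK x(2)])
  note q = IrrE[OF K x(1) xK]
  define G' where "G' = (\<lambda>q. (eval q x, eval (map f q) y)) ` carrier (K[X])"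
  have zero: "eval (map f r) y = \<zero>" if r: "r \<in> carrier (K[X])" "eval r x = \<zero>" for r
  proof -
    have "Irr K x divides\<^bsub>K[X]\<^esub> r"
      using Irr_minimal[OF K x(1) xK r] pdivides_iff_shell[OF K q(1) r(1)] by blast
    then obtain s where "s \<in> carrier (K[X])" "r = Irr K x \<otimes>\<^bsub>K[X]\<^esub> s" unfolding factor_def by blast
    then show ?thesis using q(1) y(2) by (simp add: K_def[symmetric])
  qed
  have alg: "subfield {x \<in> carrier R. (algebraic over C) x} R" by (rule subfield_of_algebraics[OF C])
  have "simple_extension K x \<subseteq> {x \<in> carrier R. (algebraic over C) x}"
    using D(1,3) x by (intro simple_extension_subring_incl[OF subfieldE(1)[OF alg]]) (auto simp: K_def)
  then have "G' \<subseteq> {x \<in> carrier R. (algebraic over C) x} \<times> carrier R"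
    unfolding G'_def simple_extension_as_eval_img[OF subfieldE(3)[OF K] x(1)] by auto
  moreover have GG': "G \<subseteq> G'"
  proof safe
    fix k u assume "(k, u) \<in> G"
    then have k: "k \<in> K" "u = f k" using f(2) by (auto simp: K_def)
    have kc: "k \<in> carrier R" "f k \<in> carrier R" using k D(1,2)[OF \<open>(k, u) \<in> G\<close>] by auto
    show "(k, u) \<in> G'"
    \<comment> \<open>The constant k is the list \<open>[k]\<close> only for nonzero k; the zero
      polynomial is \<open>[]\<close>.\<close>
    proof (cases "k = \<zero>")
      case True
      have "f \<zero> = \<zero>"
        using ring_hom_zero[OF f(1)] subring_is_ring[OF sub] ring_axioms by (simp add: K_def)
      then show ?thesis unfolding G'_def k(2) True
        by (intro image_eqI[of _ _ "[]"]) auto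
    next
      case False
      then have "[k] \<in> carrier (K[X])"
        using k by (simp add: univ_poly_carrier[symmetric] polynomial_def)
      then show ?thesis unfolding G'_def k(2) using kc
        by (intro image_eqI[of _ _ "[k]"]) auto
    qed
  qed
  moreover have "Id_on C \<subseteq> G'" using GG' D(4) by blast
  moreover have "single_valued G'"
  proof (rule single_valuedI)
    fix a u v assume "(a, u) \<in> G'" "(a, v) \<in> G'"
    then obtain r s where rs: "r \<in> carrier (K[X])" "s \<in> carrier (K[X])" "eval r x = eval s x"
      "u = eval (map f r) y" "v = eval (map f s) y" unfolding G'_def by auto
    have "eval (map f (r \<ominus>\<^bsub>K[X]\<^esub> s)) y = \<zero>"
      using rs by (intro zero) (simp_all add: a_minus_def r_neg)
    then have "u \<ominus> v = \<zero>" using rs by (simp add: a_minus_def)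
    then show "u = v" using rs by simp
  qed
  moreover have "(a \<oplus> b, u \<oplus> v) \<in> G' \<and> (a \<otimes> b, u \<otimes> v) \<in> G'"
    if ab: "(a, u) \<in> G'" "(b, v) \<in> G'" for a u b v
  proof -
    obtain r s where rs: "r \<in> carrier (K[X])" "s \<in> carrier (K[X])" "a = eval r x" "b = eval s x"
      "u = eval (map f r) y" "v = eval (map f s) y" using ab unfolding G'_def by auto
    then show ?thesis
      unfolding G'_def
      by (intro conjI image_eqI[of _ _ "r \<oplus>\<^bsub>K[X]\<^esub> s"] image_eqI[of _ _ "r \<otimes>\<^bsub>K[X]\<^esub> s"]) simp_all
  qed
  ultimately have "partial_hom C G'" unfolding partial_hom_def by blast
  moreover have "(x, y) \<in> G'"
  proof -
    have "\<one> \<in> C" "\<zero> \<in> C" using subringE(2,3)[OF subfieldE(1)[OF C]] by auto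
    then have f1: "f \<one> = \<one>" "f \<zero> = \<zero>" using D(4) f(2) by metis+
    have "[\<one>, \<zero>] \<in> carrier (K[X])"
      using subringE(2,3)[OF sub] by (simp add: univ_poly_carrier[symmetric] polynomial_def)
    then show ?thesis unfolding G'_def using x y f1
      by (intro image_eqI[of _ _ "[\<one>, \<zero>]"]) auto
  qed
  ultimately show ?thesis using GG' by blast
qed

text \<open>Over the larger field \<open>K\<close> the minimal polynomial of x divides the one over
  C. Since f fixes the coefficients of the latter, the image of the former divides it too, and so
  splits and has a root to which x can be sent.\<close>

lemma partial_hom_extend:
  assumes C: "subfield C R" and G: "partial_hom C G"
    and x: "x \<in> carrier R" "(algebraic over C) x" and splits: "splitted (Irr C x)"
  shows "\<exists>G'. partial_hom C G' \<and> G \<subseteq> G' \<and> x \<in> Domain G'"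
proof -
  obtain f where f: "f \<in> ring_hom (R\<lparr>carrier := Domain G\<rparr>) R" "\<And>c. c \<in> C \<Longrightarrow> f c = c"
    "\<And>x u. (x, u) \<in> G \<longleftrightarrow> x \<in> Domain G \<and> u = f x"
    using partial_hom_function[OF C G] by auto
  define K where "K = Domain G"
  have K: "subfield K R" unfolding K_def by (rule partial_hom_subfield[OF C G])
  note sub = subfieldE(1)[OF K]
  have CK: "C \<subseteq> K" using partial_homD(4)[OF G] unfolding K_def by blast
  have xK: "(algebraic over K) x" by (rule algebraic_mono[OF CK x(2)])
  note P = IrrE[OF C x] and q = IrrE[OF K x(1) xK]
  have PK: "Irr C x \<in> carrier (K[X])"
    using P(1) CK by (auto simp: univ_poly_carrier[symmetric] polynomial_def)
  have PR: "Irr C x \<in> carrier (poly_ring R)" by (rule carrier_polynomial_shell[OF sub PK])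
  have nz: "Irr C x \<noteq> []" using pirreducibleE[OF subfieldE(1)[OF C] P(1,2)] by blast
  have m: "map f \<in> ring_hom (K[X]) (poly_ring R)"
    by (rule map_ring_hom[OF K f(1)[folded K_def]])
  have "Irr K x divides\<^bsub>K[X]\<^esub> Irr C x"
    using Irr_minimal[OF K x(1) xK PK P(4)] pdivides_iff_shell[OF K q(1) PK] by blast
  then obtain s where s: "s \<in> carrier (K[X])" "Irr C x = Irr K x \<otimes>\<^bsub>K[X]\<^esub> s"
    unfolding factor_def by blast
  have "set (Irr C x) \<subseteq> C" using P(1) polynomial_incl univ_poly_carrier by blast
  then have "map f (Irr C x) = Irr C x" using f(2) by (intro map_idI) auto
  then have "Irr C x = map f (Irr K x) \<otimes>\<^bsub>poly_ring R\<^esub> map f s"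
    using ring_hom_mult[OF m q(1) s(1)] s(2) by simp
  then have dvd: "map f (Irr K x) pdivides Irr C x"
    unfolding pdivides_def using dividesI ring_hom_closed[OF m s(1)] by blast
  have mq: "map f (Irr K x) \<in> carrier (poly_ring R)" by (rule ring_hom_closed[OF m q(1)])
  have "splitted (map f (Irr K x))" by (rule pdivides_imp_splitted[OF mq PR nz splits dvd])
  then have "roots (map f (Irr K x)) \<noteq> {#}"
    using pirreducible_degree[OF K q(1,2)] unfolding splitted_def by auto
  then obtain y where "is_root (map f (Irr K x)) y" using roots_mem_iff_is_root[OF mq] by blast
  then show ?thesis
    using partial_hom_extend_root[OF C G f(1,3) x, of y] unfolding K_def is_root_def by blast
qed

lemma partial_hom_Id:
  assumes C: "subfield C R"
  shows "partial_hom C (Id_on C)"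
proof -
  note sub = subfieldE(1)[OF C]
  have "c \<in> carrier R" "(algebraic over C) c" if "c \<in> C" for c
    using subsetD[OF subringE(1)[OF sub] that] algebraic_self[OF sub that] .
  then have "Id_on C \<subseteq> {x \<in> carrier R. (algebraic over C) x} \<times> carrier R"
    unfolding Id_on_def by blast
  moreover have "(x \<oplus> y, u \<oplus> v) \<in> Id_on C \<and> (x \<otimes> y, u \<otimes> v) \<in> Id_on C"
    if "(x, u) \<in> Id_on C" "(y, v) \<in> Id_on C" for x u y v
    using that subringE(6,7)[OF sub] by auto
  moreover have "single_valued (Id_on C)" by (auto simp: single_valued_def)
  ultimately show ?thesis
    unfolding partial_hom_def by blast
qed

text \<open>Zorn's lemma above the partial homomorphism \<open>G0\<close> with x sent to y: by the
  extension step a maximal one is defined on all of \<open>E\<close>.\<close>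

lemma normal_extension_automorphism:
  assumes C: "subfield C R"
    and splits: "\<And>x. x \<in> carrier R \<Longrightarrow> (algebraic over C) x \<Longrightarrow> splitted (Irr C x)"
    and x: "x \<in> carrier R" "(algebraic over C) x"
    and y: "y \<in> carrier R" "eval (Irr C x) y = \<zero>"
  defines "E \<equiv> {z \<in> carrier R. (algebraic over C) z}"
  obtains f where "f \<in> ring_hom (R\<lparr>carrier := E\<rparr>) R" "bij_betw f E E"
    "\<And>c. c \<in> C \<Longrightarrow> f c = c" "f x = y"
proof -
  note sub = subfieldE(1)[OF C]
  have "map id (Irr C x) = Irr C x" by simp
  moreover have "id \<in> ring_hom (R\<lparr>carrier := C\<rparr>) R"
    using subfieldE(3)[OF C] by (intro ring_hom_memI) auto
  ultimately obtain G0 where G0: "partial_hom C G0" "(x, y) \<in> G0"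
    using partial_hom_extend_root[OF C partial_hom_Id[OF C] _ _ x y(1), of id] y(2) by auto
  let ?A = "{G. partial_hom C G \<and> G0 \<subseteq> G}"
  have "\<exists>M\<in>?A. \<forall>G\<in>?A. M \<subseteq> G \<longrightarrow> G = M"
  proof (rule subset_Zorn_nonempty)
    show "?A \<noteq> {}" using G0 by blast
    fix \<G> assume \<G>: "\<G> \<noteq> {}" "subset.chain ?A \<G>"
    then have "subset.chain (Collect (partial_hom C)) \<G>" unfolding subset_chain_def by blast
    then have "partial_hom C (\<Union>\<G>)" by (rule partial_hom_Union[OF _ \<G>(1)])
    then show "\<Union>\<G> \<in> ?A" using \<G> unfolding subset_chain_def by blast
  qed
  then obtain G where GA: "G \<in> ?A" "\<forall>G'\<in>?A. G \<subseteq> G' \<longrightarrow> G' = G" by (rule bexE)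
  then have G: "partial_hom C G" "G0 \<subseteq> G" by simp_all
  have max: "G' = G" if "partial_hom C G'" "G \<subseteq> G'" for G'
    using GA(2) that G(2) by simp
  have Ed: "z \<in> carrier R" "(algebraic over C) z" if "z \<in> E" for z
    using that unfolding E_def by simp_all
  have EI: "z \<in> E" if "z \<in> carrier R" "(algebraic over C) z" for z
    using that unfolding E_def by simp
  have DE: "Domain G = E"
  proof (intro equalityI subsetI)
    fix z assume "z \<in> E"
    note z = Ed[OF this]
    obtain G' where G': "partial_hom C G'" "G \<subseteq> G'" "z \<in> Domain G'"
      using partial_hom_extend[OF C G(1) z splits[OF z]] by auto
    then show "z \<in> Domain G" using max[OF G'(1,2)] by simp
  next
    fix z assume "z \<in> Domain G"
    then obtain u where "(z, u) \<in> G" by auto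
    from partial_homD(1,3)[OF G(1) this] show "z \<in> E" by (rule EI)
  qed
  obtain f where f: "f \<in> ring_hom (R\<lparr>carrier := E\<rparr>) R" "\<And>c. c \<in> C \<Longrightarrow> f c = c"
    "\<And>x u. (x, u) \<in> G \<longleftrightarrow> x \<in> E \<and> u = f x"
    using partial_hom_function[OF C G(1)] unfolding DE by auto
  have E: "subfield E R" unfolding E_def by (rule subfield_of_algebraics[OF C])
  interpret f: ring_hom_ring "R\<lparr>carrier := E\<rparr>" R f
    by (rule ring_hom_ringI2[OF subring_is_ring[OF subfieldE(1)[OF E]] ring_axioms f(1)])
  have inj: "inj_on f E"
    using non_trivial_field_hom_is_inj[OF f(1) subfield_iff(2)[OF E] field_axioms] by simp
  have root: "f z \<in> carrier R \<and> eval q (f z) = \<zero>"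
    if "z \<in> E" "q \<in> carrier (C[X])" "eval q z = \<zero>" for z q
  proof -
    have q: "set q \<subseteq> C" using that(2) polynomial_incl univ_poly_carrier by blast
    then have "map f q = q" using f(2) by (intro map_idI) auto
    moreover have "set q \<subseteq> E"
      using q EI[OF subsetD[OF subringE(1)[OF sub]] algebraic_self[OF sub]] by blast
    ultimately show ?thesis
      using f.eval_hom'[of z q] that eval_consistent[OF subfieldE(1)[OF E]] f.hom_closed[of z] f.hom_zero
      by auto
  qed
  have nz: "Irr C z \<noteq> []" if "z \<in> E" for z
    using pirreducibleE(1)[OF sub IrrE(1,2)[OF C Ed[OF that]]] .
  have rootE: "z \<in> E" if "is_root q z" "q \<in> carrier (C[X])" for q z
    using that(1) EI[OF _ algebraicI[OF that(2)]] unfolding is_root_def by simp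
  have "f ` E = E"
  proof (intro equalityI subsetI)
    fix w assume "w \<in> f ` E"
    then obtain z where z: "z \<in> E" "w = f z" by blast
    note P = IrrE[OF C Ed[OF z(1)]]
    have "is_root (Irr C z) w"
      using root[OF z(1) P(1,4)] nz[OF z(1)] unfolding is_root_def z(2) by simp
    then show "w \<in> E" using P(1) by (rule rootE)
  next
    fix w assume w: "w \<in> E"
    \<comment> \<open>Surjectivity comes from finiteness: f maps the roots of the minimal polynomial
      of w injectively into themselves, hence permutes them.\<close>
    define S where "S = {z. is_root (Irr C w) z}"
    note P = IrrE[OF C Ed[OF w]]
    have "finite S"
      unfolding S_def by (rule finite_number_of_roots[OF carrier_polynomial_shell[OF sub P(1)]])
    moreover have SE: "S \<subseteq> E" unfolding S_def using rootE[OF _ P(1)] by auto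
    moreover have "f ` S \<subseteq> S"
    proof safe
      fix z assume z: "z \<in> S"
      then have "z \<in> E" "eval (Irr C w) z = \<zero>" using SE by (auto simp: S_def is_root_def)
      then show "f z \<in> S" using root[OF _ P(1)] nz[OF w] by (simp add: S_def is_root_def)
    qed
    ultimately have "f ` S = S"
      using inj by (meson endo_inj_surj inj_on_subset)
    moreover have "w \<in> S" unfolding S_def is_root_def using Ed[OF w] P(4) nz[OF w] by simp
    ultimately show "w \<in> f ` E" using SE by blast
  qed
  then have "bij_betw f E E" using inj unfolding bij_betw_def by blast
  moreover have "f x = y" using subsetD[OF G(2) G0(2)] f(3)[of x y] by simp
  ultimately show ?thesis using that f(1,2) by blast
qed

end

section \<open>Subfields of the ambient field\<close>

text \<open>The two rings are different records whose operations need to agree only on the smaller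
  carrier. With \<open>id\<close> as the homomorphism, notions of M and of \<open>M\<^sub>0\<close>
  can be compared without renaming elements.\<close>

locale field_inclusion = ring_hom_ring R S id for R :: "'a ring" and S :: "'a ring" +
  assumes R: "field R" and S: "field S"
begin

lemma independent_iff:
  assumes K: "K \<subseteq> carrier R" and us: "set us \<subseteq> carrier R"
  shows "S.independent K us \<longleftrightarrow> R.independent K us"
  using us
proof (induct us)
  case (Cons u us)
  then have u: "u \<in> carrier R" "u \<in> carrier S" and us: "set us \<subseteq> carrier R"
    using hom_closed[of u] by auto
  have "S.Span K us = R.Span K us" using Span_hom[OF K us] by simp
  then show ?case
    using Cons.hyps[OF us] u R.independent_backwards[of K u us] S.independent_backwards[of K u us]
      R.independent.li_Cons[of u K us] S.independent.li_Cons[of u K us] by metis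
qed simp

lemma algebraic_iff:
  assumes K: "subfield K R" and x: "x \<in> carrier R"
  shows "(S.algebraic over K) x \<longleftrightarrow> (R.algebraic over K) x"
proof -
  note sub = subfieldE(1)[OF K]
  have KS: "subfield K S" using img_is_subfield(2)[OF K one_not_zero[OF S]] by simp
  have x': "x \<in> carrier S" using hom_closed[OF x] by simp
  have X: "carrier (K[X]\<^bsub>S\<^esub>) = carrier (K[X]\<^bsub>R\<^esub>)"
    using hom_zero by (simp add: univ_poly_def polynomial_def)
  have ev: "S.eval q x = R.eval q x" if "q \<in> carrier (K[X]\<^bsub>R\<^esub>)" for q
    using eval_hom[OF sub x that] by simp
  show ?thesis
  proof
    assume "(S.algebraic over K) x"
    then obtain q where "q \<in> carrier (K[X]\<^bsub>S\<^esub>)" "q \<noteq> []" "S.eval q x = \<zero>\<^bsub>S\<^esub>"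
      using domain.algebraicE[OF field.axioms(1)[OF S] subfieldE(1)[OF KS] x'] by metis
    then show "(R.algebraic over K) x"
      using R.algebraicI[of q K x] ev[of q] hom_zero by (simp add: X)
  next
    assume "(R.algebraic over K) x"
    then obtain q where "q \<in> carrier (K[X]\<^bsub>R\<^esub>)" "q \<noteq> []" "R.eval q x = \<zero>\<^bsub>R\<^esub>"
      using domain.algebraicE[OF field.axioms(1)[OF R] sub x] by metis
    then show "(S.algebraic over K) x"
      using S.algebraicI[of q K x] ev[of q] hom_zero by (simp add: X)
  qed
qed

lemma subfield_restrict:
  assumes K: "subfield K S" "K \<subseteq> carrier R"
  shows "subfield K R"
proof -
  interpret R: field R by (rule R)
  interpret S: field S by (rule S)
  show ?thesis
  proof (rule R.subfieldI'[OF R.subringI])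
    note sub = subringE[OF subfieldE(1)[OF K(1)]]
    show "K \<subseteq> carrier R" by fact
    show "\<one>\<^bsub>R\<^esub> \<in> K" using sub(3) hom_one by simp
    show "\<ominus>\<^bsub>R\<^esub> a \<in> K" if "a \<in> K" for a
      using sub(5)[OF that] hom_a_inv[of a] that K(2) by (simp add: subset_iff)
    show "a \<otimes>\<^bsub>R\<^esub> b \<in> K" "a \<oplus>\<^bsub>R\<^esub> b \<in> K" if "a \<in> K" "b \<in> K" for a b
      using sub(6,7)[OF that] hom_mult[of a b] hom_add[of a b] that K(2) by (simp_all add: subset_iff)
    fix a assume a: "a \<in> K - {\<zero>\<^bsub>R\<^esub>}"
    then have a': "a \<in> carrier R" "a \<in> K - {\<zero>\<^bsub>S\<^esub>}" using K(2) hom_zero by auto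
    have u: "a \<in> Units R" using a a' R.field_Units by simp
    have "a \<otimes>\<^bsub>S\<^esub> inv\<^bsub>R\<^esub> a = \<one>\<^bsub>S\<^esub>"
      using hom_mult[of a "inv\<^bsub>R\<^esub> a"] u a' R.Units_r_inv[OF u] hom_one by simp
    moreover have "a \<in> carrier S" "inv\<^bsub>R\<^esub> a \<in> carrier S"
      using hom_closed[of a] hom_closed[of "inv\<^bsub>R\<^esub> a"] u a' by simp_all
    ultimately have "inv\<^bsub>S\<^esub> a = inv\<^bsub>R\<^esub> a" by (rule S.comm_inv_char[rotated 2])
    then show "inv\<^bsub>R\<^esub> a \<in> K" using S.subfield_m_inv(1)[OF K(1) a'(2)] by simp
  qed
qed

lemma separable_ext_restrict:
  assumes sep: "separable_ext S p (carrier R) C" and C: "C \<subseteq> carrier R"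
  shows "separable_ext R p (carrier R) C"
proof -
  have pow: "x [^]\<^bsub>S\<^esub> p = x [^]\<^bsub>R\<^esub> p" if "x \<in> carrier R" for x
    using hom_nat_pow[OF that, of p] by simp
  have img: "(\<lambda>x. x [^]\<^bsub>S\<^esub> p) ` K = (\<lambda>x. x [^]\<^bsub>R\<^esub> p) ` K" if "K \<subseteq> carrier R" for K
    using that pow by (intro image_cong) auto
  have cl: "(\<lambda>x. x [^]\<^bsub>R\<^esub> p) ` K \<subseteq> carrier R" if "K \<subseteq> carrier R" for K
    using that by auto
  have ind: "S.independent ((\<lambda>x. x [^]\<^bsub>R\<^esub> p) ` K) us \<longleftrightarrow> R.independent ((\<lambda>x. x [^]\<^bsub>R\<^esub> p) ` K) us"
    if "K \<subseteq> carrier R" "set us \<subseteq> C" for K us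
    using that C by (intro independent_iff cl) auto
  show ?thesis
    using sep ind[OF C] ind[OF subset_refl]
    unfolding separable_ext_def linearly_disjoint_def img[OF C] img[OF subset_refl] by auto
qed

end

section \<open>Application to the model\<close>

lemma ring_of_id_hom:
  fixes M :: "('a, 'f fsym, 'r) fo_structure" and M\<^sub>0 :: "'a ring"
  assumes "is_substructure L0 M (field_structure M\<^sub>0)"
  shows "id \<in> ring_hom (ring_of M) M\<^sub>0"
proof -
  have sub: "univ M \<subseteq> carrier M\<^sub>0"
    and f: "\<And>g xs. g \<in> Funs (L0 :: ('f fsym, 'r) language) \<Longrightarrow>
      xs \<in> tuples (farity (L0 :: ('f fsym, 'r) language) g) (univ M) \<Longrightarrow> fint M g xs = field_op M\<^sub>0 g xs"
    using assms unfolding is_substructure_def field_structure_def by auto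
  show ?thesis
    by (rule ring_hom_memI) (use sub f in \<open>auto simp: ring_of_def L0_def tuples_def\<close>)
qed

lemma (in char_field) separably_closed_automorphism:
  assumes sc: "separably_closed R" and C: "subfield C R" and sep: "separable_ext R p (carrier R) C"
    and x: "x \<in> carrier R" "(algebraic over C) x" "x \<notin> C"
  defines "E \<equiv> {z \<in> carrier R. (algebraic over C) z}"
  shows "\<exists>f\<in>ring_hom (R\<lparr>carrier := E\<rparr>) R. bij_betw f E E \<and> (\<forall>c\<in>C. f c = c) \<and> f x \<noteq> x"
proof -
  have splits: "splitted (Irr C z)" if "z \<in> carrier R" "(algebraic over C) z" for z
    using sc separable_Irr(1)[OF C that formal_deriv_Irr_nonzero[OF C that sep]]
    unfolding separably_closed_def by blast
  obtain y where y: "y \<in> carrier R" "y \<noteq> x" "eval (Irr C x) y = \<zero>"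
    using exists_other_root[OF C x formal_deriv_Irr_nonzero[OF C x(1,2) sep] splits[OF x(1,2)]] .
  show ?thesis
  proof (rule normal_extension_automorphism[OF C splits x(1,2) y(1,3), folded E_def])
    fix f assume f: "f \<in> ring_hom (R\<lparr>carrier := E\<rparr>) R" "bij_betw f E E"
      "\<And>c. c \<in> C \<Longrightarrow> f c = c" "f x = y"
    show ?thesis by (rule bexI[OF _ f(1)]) (simp add: f(2-4) y(2))
  qed
qed

theorem lemma1p13:
  fixes L :: "('f fsym, 'r) language"
    and T :: "('f fsym, 'r) fm set"
    and p :: nat
    and M :: "('a, 'f fsym, 'r) fo_structure"
    and M\<^sub>0 :: "'a ring"
    and \<kappa> :: "'k rel"
    and \<mu> :: "'l rel"
  assumes "sublanguage L0 L"
    and "complete_theory TYPE('a) L T"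
    and "p = 0 \<or> Factorial_Ring.prime p"
    and "\<And>N :: ('a, 'f fsym, 'r) fo_structure.
           is_model L T N \<Longrightarrow> is_field_structure N \<and> has_char (ring_of N) p"
    and "algebraically_closed M\<^sub>0"
    and "Card_order \<mu>" and "|lformulas (L0 :: ('f fsym, 'r) language)| <o \<mu>"
    and "saturated L0 \<mu> (field_structure M\<^sub>0 :: ('a, 'f fsym, 'r) fo_structure)"
    and "Card_order \<kappa>" and "|lformulas L| <o \<kappa>"
    and "is_model L T M" and "saturated L \<kappa> M"
    and "is_substructure L0 M (field_structure M\<^sub>0)"
    and "\<exists>\<K>. substructure_class L M \<K> \<and> strong_class L M \<K> \<and>
           hypothesis_1 L M \<K> \<and> hypothesis_2 L T p M\<^sub>0 M \<K> \<and>
           hypothesis_3 L M\<^sub>0 M \<K> \<and> hypothesis_4 L \<kappa> M\<^sub>0 M \<K>"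
  shows "property_star L \<kappa> M\<^sub>0 M"
  unfolding property_star_def
proof (intro allI impI subsetI, elim conjE)
  fix N A B c
  assume N: "elementary_sub L M N" "|N| <o \<kappa>"
    and AB: "A \<subseteq> univ M" "B \<subseteq> univ M" "A = dcl L M A" "B = dcl L M B" "N \<subseteq> A" "N \<subseteq> B"
      "independent_over L M N A B"
    and c: "c \<in> dcl L M (A \<union> B)"
  obtain \<K> where \<K>: "substructure_class L M \<K>" "strong_class L M \<K>" "hypothesis_1 L M \<K>"
    "hypothesis_2 L T p M\<^sub>0 M \<K>" "hypothesis_3 L M\<^sub>0 M \<K>" "hypothesis_4 L \<kappa> M\<^sub>0 M \<K>"
    using assms(14) by blast
  define R where "R = ring_of M"
  have carrier: "carrier R = univ M" by (simp add: R_def ring_of_def)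
  have "field R" "has_char R p"
    using assms(4)[OF assms(11)] by (simp_all add: R_def is_field_structure_def)
  interpret R: char_field R p
    using \<open>field R\<close> \<open>has_char R p\<close> assms(3)
    by (simp add: plain_field_def char_field_def char_field_axioms_def)
  interpret S: algebraically_closed M\<^sub>0 by (rule assms(5))
  have hom: "id \<in> ring_hom R M\<^sub>0" unfolding R_def by (rule ring_of_id_hom[OF assms(13)])
  interpret incl: field_inclusion R M\<^sub>0
    by (rule field_inclusion.intro[OF ring_hom_ringI2[OF R.ring_axioms S.ring_axioms hom]])
      (simp add: field_inclusion_axioms_def R.field_axioms S.field_axioms)
  have sub0: "univ M \<subseteq> carrier M\<^sub>0" using ring_hom_closed[OF hom] carrier by auto
  define C where "C = compositum M\<^sub>0 A B"
  have ABK: "A \<in> \<K>" "B \<in> \<K>" using \<K>(3) AB(1-4) unfolding hypothesis_1_def by simp_all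
  then have CK: "C \<in> \<K>"
    using \<K>(6) N AB(5-7) unfolding hypothesis_4_def C_def by blast
  then have "is_substructure L (M\<lparr>univ := C\<rparr>) M" using \<K>(1) unfolding substructure_class_def by blast
  then have CM: "C \<subseteq> univ M" by (simp add: is_substructure_def)
  have AB0: "A \<union> B \<subseteq> carrier M\<^sub>0" using AB(1,2) sub0 by blast
  have C0: "subfield C M\<^sub>0" unfolding C_def compositum_def by (rule S.generate_field_is_subfield[OF AB0])
  have ABC: "A \<union> B \<subseteq> C" unfolding C_def compositum_def by (auto intro: generate_field.incl)
  have C: "subfield C R" by (rule incl.subfield_restrict[OF C0]) (simp add: carrier CM)
  define E where "E = {z \<in> carrier R. (R.algebraic over C) z}"
  \<comment> \<open>\<open>acl_field\<close> means algebraic over the generated field, which here is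
    C itself.\<close>
  have "generate_field M\<^sub>0 C = C"
    by (rule S.generate_fieldI[OF subfieldE(3)[OF C0] C0, symmetric]) auto
  then have "acl_field M\<^sub>0 C \<inter> univ M = E"
    unfolding acl_field_def E_def using incl.algebraic_iff[OF C] sub0 by (auto simp: carrier)
  then have H3: "acl L M C = E"
    "\<And>f. f \<in> ring_iso (M\<^sub>0\<lparr>carrier := E\<rparr>) (M\<^sub>0\<lparr>carrier := E\<rparr>) \<Longrightarrow> (\<forall>a\<in>C. f a = a) \<Longrightarrow> l_iso L M E E f"
    using \<K>(5) CK unfolding hypothesis_3_def by (auto simp: Let_def)
  have EM: "E \<subseteq> univ M" by (auto simp: E_def carrier)
  have EK: "E \<in> \<K>"
    using \<K>(3) EM dcl_acl[of L M C] unfolding hypothesis_1_def H3(1) by simp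
  have dclE: "dcl L M (A \<union> B) \<subseteq> E"
    using subset_trans[OF dcl_subset_acl acl_mono[OF ABC], of L M] unfolding H3(1) .
  have cE: "c \<in> E" by (rule subsetD[OF dclE c])
  have sep: "separable_ext R p (carrier R) C"
    using \<K>(4) CK unfolding hypothesis_2_def
    by (intro incl.separable_ext_restrict) (simp_all add: carrier CM)
  have sc: "separably_closed R"
    using \<K>(4) assms(11) unfolding hypothesis_2_def R_def by simp
  show "c \<in> compositum M\<^sub>0 A B"
  proof (rule ccontr)
    assume "c \<notin> compositum M\<^sub>0 A B"
    then have "c \<in> carrier R" "(R.algebraic over C) c" "c \<notin> C"
      using cE by (simp_all add: E_def C_def)
    from R.separably_closed_automorphism[OF sc C sep this, folded E_def]
    obtain f where f: "f \<in> ring_hom (R\<lparr>carrier := E\<rparr>) R" "bij_betw f E E"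
      "\<forall>c\<in>C. f c = c" "f c \<noteq> c" by blast
    have fE: "f z \<in> E" if "z \<in> E" for z using f(2) that by (auto simp: bij_betw_def)
    have Ec: "z \<in> carrier R" if "z \<in> E" for z using that by (simp add: E_def)
    \<comment> \<open>The automorphism was built for the operations of M; Hypothesis 3 asks for
      those of \<open>M\<^sub>0\<close> restricted to \<open>E\<close>.\<close>
    have "f \<in> ring_hom (M\<^sub>0\<lparr>carrier := E\<rparr>) (M\<^sub>0\<lparr>carrier := E\<rparr>)"
    proof (rule ring_hom_memI)
      fix x y assume "x \<in> carrier (M\<^sub>0\<lparr>carrier := E\<rparr>)" "y \<in> carrier (M\<^sub>0\<lparr>carrier := E\<rparr>)"
      then have xy: "x \<in> E" "y \<in> E" by auto
      show "f (x \<otimes>\<^bsub>M\<^sub>0\<lparr>carrier := E\<rparr>\<^esub> y) = f x \<otimes>\<^bsub>M\<^sub>0\<lparr>carrier := E\<rparr>\<^esub> f y"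
        using ring_hom_mult[OF f(1), of x y] incl.hom_mult[of x y] incl.hom_mult[of "f x" "f y"]
          xy Ec fE by simp
      show "f (x \<oplus>\<^bsub>M\<^sub>0\<lparr>carrier := E\<rparr>\<^esub> y) = f x \<oplus>\<^bsub>M\<^sub>0\<lparr>carrier := E\<rparr>\<^esub> f y"
        using ring_hom_add[OF f(1), of x y] incl.hom_add[of x y] incl.hom_add[of "f x" "f y"]
          xy Ec fE by simp
    next
      show "f \<one>\<^bsub>M\<^sub>0\<lparr>carrier := E\<rparr>\<^esub> = \<one>\<^bsub>M\<^sub>0\<lparr>carrier := E\<rparr>\<^esub>"
        using ring_hom_one[OF f(1)] incl.hom_one by simp
    qed (use fE in auto)
    then have "f \<in> ring_iso (M\<^sub>0\<lparr>carrier := E\<rparr>) (M\<^sub>0\<lparr>carrier := E\<rparr>)"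
      using f(2) by (simp add: ring_iso_def)
    then have "l_iso L M E E f" using H3(2) f(3) by blast
    then have "elementary_map L M E f" using \<K>(2) EK unfolding strong_class_def by blast
    then have "f c = c"
    proof (rule elementary_map_fixes_dcl)
      show "f a = a" if "a \<in> A \<union> B" for a using f(3) ABC that by blast
      show "A \<union> B \<subseteq> E"
        by (rule subset_trans[OF subset_dcl dclE]) (use AB(1,2) in blast)
      show "c \<in> dcl L M (A \<union> B)" by (rule c)
      show "c \<in> E" by (rule cE)
      show "f c \<in> univ M" using fE[OF cE] EM by blast
    qed
    then show False using f(4) by simp
  qed
qed

end
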